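(* Let $R=K[x_1,\dots,x_n]$ be a polynomial ring over a field $K$. Let $J\subset R$ be an integrally closed strongly stable ideal, and let $I=\bigcap_{\sigma\in\mathfrak S_n}\sigma(J)$ be its symmetrization. Then $I$ is an integrally closed symmetric strongly shifted ideal. Moreover, if $I$ is a symmetric strongly shifted ideal such that $\mathrm{Borel}(x^{B(I)})$ is normal, then $I$ is normal. In particular, a symmetric strongly shifted ideal $I$ is normal if either of the following conditions holds: (1) $B(I)=\{\lambda\}$ for some $\lambda\in P_n$, i.e. $I$ is a principal Borel symmetric strongly shifted ideal; or (2) $\mathrm{Borel}(x^{B(I)})$ is an equigenerated lex-segment ideal.
   Context: $\mathfrak S_n$ acts on $R$ by permuting variables. $P_n=\{\lambda\in\mathbb Z^n: 0\le\lambda_1\le\cdots\le\lambda_n\}$, $x^\lambda=x_1^{\lambda_1}\cdots x_n^{\lambda_n}$, $x^B=\{x^\lambda:\lambda\in B\}$ for $B\subseteq P_n$. For an $\mathfrak S_n$-fixed monomial ideal $I$ put $P(I)=\{\lambda\in P_n: x^\lambda\in I\}$. An $\mathfrak S_n$-fixed monomial ideal $I$ is symmetric strongly shifted if for every $\lambda\in P(I)$ and $1\le i<j\le n$ with $\lambda_i<\lambda_j$ one has $x^\lambda x_i/x_j\in I$. A monomial ideal $J$ is strongly stable if for every monomial $x^\alpha\in J$ and every $i<j$ with $\alpha_j\ne0$ one has $x^\alpha x_i/x_j\in J$. $\mathrm{Borel}(M)$ is the smallest strongly stable ideal containing the set of monomials $M$. $\mathrm{Sss}(B)$ is the smallest symmetric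 strongly shifted ideal containing $x^B$, and $B(I)$, the set of partition Borel generators of a symmetric strongly shifted ideal $I$, is the smallest $B\subseteq P_n$ with $I=\mathrm{Sss}(B)$. An ideal is normal if all its powers are integrally closed. Equigenerated means that all minimal generators have the same degree. A monomial ideal is a lex-segment ideal if for every $d$ the degree-$d$ monomials in it form a lex-segment: whenever $u$ is a degree-$d$ monomial in the ideal, so is every degree-$d$ monomial larger than $u$ in the lexicographic order ($x_1>\cdots>x_n$). All ideals considered are proper. *)

theory Defs
  imports Complex_Main "HOL-Library.Poly_Mapping"
begin

text \<open>
  The variables are indexed by a finite linearly ordered type \<open>'n\<close>, so \<open>n = CARD('n)\<close> and
  \<open>x\<^sub>1, \<dots>, x\<^sub>n\<close> are the variables in increasing order of their index. Exponent vectors are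
  \<open>'n \<Rightarrow>\<^sub>0 nat\<close>, and the polynomial ring is the monoid algebra
  \<open>('n \<Rightarrow>\<^sub>0 nat) \<Rightarrow>\<^sub>0 'k\<close> with its convolution product.
\<close>

type_synonym ('n, 'k) mpoly = "('n \<Rightarrow>\<^sub>0 nat) \<Rightarrow>\<^sub>0 'k"

text \<open>
  The ideals of a commutative ring are its submodules as a module over itself: \<open>ideal.subspace I\<close>
  says that \<open>I\<close> is an ideal, and \<open>ideal.span S\<close> is the ideal generated by \<open>S\<close>.
\<close>

interpretation ideal: module "(*) :: 'a::comm_ring_1 \<Rightarrow> 'a \<Rightarrow> 'a"
  by standard (simp_all add: algebra_simps)

primrec ideal_power :: "'a::comm_ring_1 set \<Rightarrow> nat \<Rightarrow> 'a set" where
  "ideal_power I 0 = UNIV"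
| "ideal_power I (Suc m) = ideal.span {a * b |a b. a \<in> I \<and> b \<in> ideal_power I m}"

definition integral_closure :: "'a::comm_ring_1 set \<Rightarrow> 'a set" where
  "integral_closure I =
     {f. \<exists>m\<ge>1. \<exists>a. (\<forall>i\<in>{1..m}. a i \<in> ideal_power I i) \<and>
           f ^ m + (\<Sum>i = 1..m. a i * f ^ (m - i)) = 0}"

definition integrally_closed :: "'a::comm_ring_1 set \<Rightarrow> bool" where
  "integrally_closed I \<longleftrightarrow> integral_closure I = I"

definition normal_ideal :: "'a::comm_ring_1 set \<Rightarrow> bool" where
  "normal_ideal I \<longleftrightarrow> (\<forall>m. integrally_closed (ideal_power I m))"

definition monomial :: "('n \<Rightarrow>\<^sub>0 nat) \<Rightarrow> ('n, 'k::comm_ring_1) mpoly" where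
  "monomial \<alpha> = Poly_Mapping.single \<alpha> 1"

definition monomial_ideal :: "('n, 'k::comm_ring_1) mpoly set \<Rightarrow> bool" where
  "monomial_ideal I \<longleftrightarrow> (\<exists>A. I = ideal.span (monomial ` A))"

text \<open>
  The exponent of \<open>x\<^sup>\<alpha> x\<^sub>i / x\<^sub>j\<close>. Subtraction of exponent vectors truncates, so this is meaningful
  only if the exponent of \<open>x\<^sub>j\<close> in \<open>x\<^sup>\<alpha> x\<^sub>i\<close> is positive.
\<close>

definition shift :: "('n \<Rightarrow>\<^sub>0 nat) \<Rightarrow> 'n \<Rightarrow> 'n \<Rightarrow> ('n \<Rightarrow>\<^sub>0 nat)" where
  "shift \<alpha> i j = \<alpha> + Poly_Mapping.single i 1 - Poly_Mapping.single j 1"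

text \<open>
  For a bijection \<open>\<sigma>\<close>, the action \<open>x\<^sub>i \<mapsto> x\<^bsub>\<sigma> i\<^esub>\<close>: the coefficient of \<open>x\<^sup>\<beta>\<close> in the image of \<open>p\<close> is the
  coefficient of \<open>x\<^bsup>\<beta> \<circ> \<sigma>\<^esup>\<close> in \<open>p\<close>.
\<close>

definition permute_vars :: "('n \<Rightarrow> 'n) \<Rightarrow> ('n, 'k::comm_ring_1) mpoly \<Rightarrow> ('n, 'k) mpoly" where
  "permute_vars \<sigma> p = Poly_Mapping.map_key (Poly_Mapping.map_key \<sigma>) p"

lemma permute_vars_monomial:
  assumes "bij \<sigma>"
  shows "permute_vars \<sigma> (monomial (Poly_Mapping.single i k)) = monomial (Poly_Mapping.single (\<sigma> i) k)"
proof -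
  have inj: "inj \<sigma>" using assms by (rule bij_is_inj)
  have "inj (Poly_Mapping.map_key \<sigma> :: _ \<Rightarrow> 'a \<Rightarrow>\<^sub>0 nat)"
  proof (rule injI)
    fix \<alpha> \<beta> :: "'a \<Rightarrow>\<^sub>0 nat"
    assume eq: "Poly_Mapping.map_key \<sigma> \<alpha> = Poly_Mapping.map_key \<sigma> \<beta>"
    show "\<alpha> = \<beta>"
    proof (rule poly_mapping_eqI)
      fix j
      obtain l where j: "j = \<sigma> l" using assms by (metis bij_pointE)
      have "Poly_Mapping.lookup (Poly_Mapping.map_key \<sigma> \<alpha>) l = Poly_Mapping.lookup (Poly_Mapping.map_key \<sigma> \<beta>) l"
        by (simp add: eq)
      then show "Poly_Mapping.lookup \<alpha> j = Poly_Mapping.lookup \<beta> j"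
        by (simp add: map_key.rep_eq[OF inj] j)
    qed
  qed
  from map_key_single[OF this, of "Poly_Mapping.single (\<sigma> i) k" "1::'b"] show ?thesis
    by (simp add: permute_vars_def monomial_def map_key_single[OF inj])
qed

definition symmetrization :: "('n, 'k::comm_ring_1) mpoly set \<Rightarrow> ('n, 'k) mpoly set" where
  "symmetrization J = (\<Inter>\<sigma>\<in>{\<sigma>. bij \<sigma>}. permute_vars \<sigma> ` J)"

definition symmetric_ideal :: "('n, 'k::comm_ring_1) mpoly set \<Rightarrow> bool" where
  "symmetric_ideal I \<longleftrightarrow> ideal.subspace I \<and> (\<forall>\<sigma>. bij \<sigma> \<longrightarrow> permute_vars \<sigma> ` I = I)"

definition partitions :: "('n::{finite, linorder} \<Rightarrow>\<^sub>0 nat) set" where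
  "partitions = {\<mu>. mono (Poly_Mapping.lookup \<mu>)}"

definition partitions_of :: "('n::{finite, linorder}, 'k::comm_ring_1) mpoly set \<Rightarrow> ('n \<Rightarrow>\<^sub>0 nat) set" where
  "partitions_of I = {\<mu> \<in> partitions. monomial \<mu> \<in> I}"

definition symmetric_strongly_shifted ::
    "('n::{finite, linorder}, 'k::comm_ring_1) mpoly set \<Rightarrow> bool" where
  "symmetric_strongly_shifted I \<longleftrightarrow> monomial_ideal I \<and> symmetric_ideal I \<and>
     (\<forall>\<mu>\<in>partitions_of I. \<forall>i j. i < j \<and> Poly_Mapping.lookup \<mu> i < Poly_Mapping.lookup \<mu> j \<longrightarrow>
        monomial (shift \<mu> i j) \<in> I)"

definition strongly_stable :: "('n::{finite, linorder}, 'k::comm_ring_1) mpoly set \<Rightarrow> bool" where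
  "strongly_stable J \<longleftrightarrow> monomial_ideal J \<and>
     (\<forall>\<alpha> i j. monomial \<alpha> \<in> J \<and> i < j \<and> Poly_Mapping.lookup \<alpha> j \<noteq> 0 \<longrightarrow> monomial (shift \<alpha> i j) \<in> J)"

definition Borel :: "('n::{finite, linorder}, 'k::comm_ring_1) mpoly set \<Rightarrow> ('n, 'k) mpoly set" where
  "Borel M = strongly_stable hull M"

definition Sss :: "('n::{finite, linorder} \<Rightarrow>\<^sub>0 nat) set \<Rightarrow> ('n, 'k::comm_ring_1) mpoly set" where
  "Sss B = symmetric_strongly_shifted hull (monomial ` B)"

text \<open>The \<open>LEAST\<close> refers to the inclusion order on sets.\<close>

definition partition_Borel_generators ::
    "('n::{finite, linorder}, 'k::comm_ring_1) mpoly set \<Rightarrow> ('n \<Rightarrow>\<^sub>0 nat) set" where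
  "partition_Borel_generators I = (LEAST B. B \<subseteq> partitions \<and> I = Sss B)"

definition total_degree :: "('n::finite \<Rightarrow>\<^sub>0 nat) \<Rightarrow> nat" where
  "total_degree \<alpha> = (\<Sum>i\<in>UNIV. Poly_Mapping.lookup \<alpha> i)"

definition minimal_generators :: "('n, 'k::comm_ring_1) mpoly set \<Rightarrow> ('n \<Rightarrow>\<^sub>0 nat) set" where
  "minimal_generators I =
     {\<alpha>. monomial \<alpha> \<in> I \<and>
          (\<forall>\<beta>. monomial \<beta> \<in> I \<and> (monomial \<beta> :: ('n, 'k) mpoly) dvd monomial \<alpha> \<longrightarrow> \<beta> = \<alpha>)}"

definition equigenerated :: "('n::finite, 'k::comm_ring_1) mpoly set \<Rightarrow> bool" where
  "equigenerated I \<longleftrightarrow>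
     (\<exists>d. \<forall>\<alpha>\<in>minimal_generators I. total_degree \<alpha> = d)"

text \<open>
  The library's linear order on exponent vectors is the lexicographic order with
  \<open>x\<^sub>1 > \<dots> > x\<^sub>n\<close>: the first index at which two exponent vectors differ decides.
\<close>

lemma exponent_less_iff:
  fixes \<alpha> \<beta> :: "'n::linorder \<Rightarrow>\<^sub>0 nat"
  shows "\<alpha> < \<beta> \<longleftrightarrow>
    (\<exists>i. Poly_Mapping.lookup \<alpha> i < Poly_Mapping.lookup \<beta> i \<and>
         (\<forall>j<i. Poly_Mapping.lookup \<alpha> j = Poly_Mapping.lookup \<beta> j))"
  by (simp add: less_poly_mapping.rep_eq less_fun_def)

definition lex_segment_ideal :: "('n::{finite, linorder}, 'k::comm_ring_1) mpoly set \<Rightarrow> bool" where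
  "lex_segment_ideal I \<longleftrightarrow> monomial_ideal I \<and>
     (\<forall>\<alpha> \<beta>. monomial \<alpha> \<in> I \<and> total_degree \<beta> = total_degree \<alpha> \<and> \<alpha> < \<beta> \<longrightarrow> monomial \<beta> \<in> I)"

end

theory Submission
  imports Defs "HOL-Library.Cardinality"
begin

text \<open>
  Monomial ideals are handled through their sets of exponents. Integral closure is functorial, so
  the symmetrization of an integrally closed ideal, an intersection of images under automorphisms,
  is integrally closed. For \<open>B = B(I)\<close> and \<open>J = Borel(x\<^sup>B)\<close>, comparison of partial sums of exponents
  shows that \<open>I\<close> is the symmetrization of \<open>J\<close>, and even that \<open>I\<^sup>m\<close> is the symmetrization of \<open>J\<^sup>m\<close> for
  all \<open>m\<close>: a partition in \<open>J\<^sup>m\<close> dominates a sum of \<open>m\<close> partitions in \<open>B\<close>, which lies in \<open>I\<^sup>m\<close>.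
  Hence \<open>I\<close> is normal if \<open>J\<close> is.

  In both special cases \<open>J\<^sup>m\<close> consists of the polynomials whose exponents \<open>\<beta>\<close> satisfy
  \<open>w \<beta> \<ge> m * c\<close> for certain pairs of an additive weight \<open>w\<close> and a bound \<open>c\<close>. Each such inequality
  is preserved by integral closure, because the order with respect to a weight is a valuation. For
  a principal Borel ideal the weights are the partial sums.
\<close>

section \<open>Monomial ideals and integral closure\<close>

text \<open>Integral closure is defined by equations, whereas powers of monomial ideals are
  described by exponents. Valuations bound the closure of \<open>J^m\<close> from above by linear
  inequalities; what remains is a decomposition problem: every exponent vector satisfying them must
  be a sum of \<open>m\<close> exponents of \<open>J\<close> plus a remainder.

  Partial sums do not suffice for lex-segment ideals, whose powers need not be lex-segment. In three
  variables, with \<open>x_2^2\<close> as the last generator, the square contains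
  \<open>x_2^4\<close> but not the larger \<open>x_1 x_3^3\<close>. A suitable weight must account
  for how many of the \<open>m\<close> factors can still be tied with the last generator at each
  position; this is the origin of \<open>carry\<close> and \<open>lex_weight\<close>.

  Partitions matter because their entries increase: among all rearrangements of a vector the sorted
  one has the smallest partial sums. It is the hardest to bring into a stable set, so membership in
  the symmetric core of a stable set is decided by the sorted vector alone.\<close>

abbreviation lookup where "lookup \<equiv> Poly_Mapping.lookup"
abbreviation keys where "keys \<equiv> Poly_Mapping.keys"

text \<open>Divisibility is expressed by adding an exponent vector, because \<open>\<le>\<close> on
  exponent vectors is the lexicographic order.\<close>

definition up_closed :: "('n \<Rightarrow>\<^sub>0 nat) set \<Rightarrow> bool" where
  "up_closed A \<longleftrightarrow> (\<forall>\<alpha>\<in>A. \<forall>\<beta>. \<alpha> + \<beta> \<in> A)"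

text \<open>Defined for every set, so that half-spaces and intersections are covered as well; it is
  an ideal as soon as \<open>A\<close> is \<open>up_closed\<close>, and it determines
  \<open>A\<close> (\<open>mono_ideal_eq_iff\<close>).\<close>

definition mono_ideal :: "('n \<Rightarrow>\<^sub>0 nat) set \<Rightarrow> ('n, 'k::comm_ring_1) mpoly set" where
  "mono_ideal A = {f. keys f \<subseteq> A}"

lemma up_closedD: "up_closed A \<Longrightarrow> \<alpha> \<in> A \<Longrightarrow> \<alpha> + \<beta> \<in> A"
  by (simp add: up_closed_def)

lemma mono_ideal_iff: "f \<in> mono_ideal A \<longleftrightarrow> keys f \<subseteq> A"
  by (simp add: mono_ideal_def)

lemma monomial_in_mono_ideal [simp]: "monomial \<alpha> \<in> mono_ideal A \<longleftrightarrow> \<alpha> \<in> A"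
  by (simp add: mono_ideal_def monomial_def)

lemma mono_ideal_mono: "A \<subseteq> B \<Longrightarrow> mono_ideal A \<subseteq> mono_ideal B"
  by (auto simp: mono_ideal_def)

lemma mono_ideal_UNIV [simp]: "mono_ideal UNIV = UNIV"
  by (simp add: mono_ideal_def)

lemma mult_in_mono_ideal:
  assumes "f \<in> mono_ideal A" "g \<in> mono_ideal B"
  shows "f * g \<in> mono_ideal {\<alpha> + \<beta> |\<alpha> \<beta>. \<alpha> \<in> A \<and> \<beta> \<in> B}"
  using assms keys_mult[of f g] unfolding mono_ideal_iff by blast

lemma subspace_mono_ideal:
  assumes "up_closed A"
  shows "ideal.subspace (mono_ideal A)"
proof (rule ideal.subspaceI)
  fix c f :: "('a, 'b) mpoly"
  assume "f \<in> mono_ideal A"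
  have "\<alpha> + \<beta> \<in> A" if "\<beta> \<in> A" for \<alpha> \<beta>
    using up_closedD[OF assms that] by (simp add: add.commute)
  with mult_in_mono_ideal[of c UNIV, OF _ \<open>f \<in> mono_ideal A\<close>] show "c * f \<in> mono_ideal A"
    by (fastforce simp: mono_ideal_iff)
next
  fix f g :: "('a, 'b) mpoly"
  assume "f \<in> mono_ideal A" "g \<in> mono_ideal A"
  then show "f + g \<in> mono_ideal A"
    using keys_add[of f g] by (auto simp: mono_ideal_iff)
qed (simp add: mono_ideal_iff)

lemma poly_eq_sum_monomials:
  fixes f :: "('n, 'k::comm_ring_1) mpoly"
  shows "f = (\<Sum>\<alpha>\<in>keys f. Poly_Mapping.single 0 (lookup f \<alpha>) * monomial \<alpha>)"
  by (rule poly_mapping_eqI)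
     (simp add: lookup_sum monomial_def mult_single lookup_single when_def not_in_keys_iff_lookup_eq_zero)

lemma mono_ideal_subset:
  fixes I :: "('n, 'k::comm_ring_1) mpoly set"
  assumes "ideal.subspace I" "monomial ` A \<subseteq> I"
  shows "mono_ideal A \<subseteq> I"
proof
  fix f :: "('n, 'k) mpoly" assume "f \<in> mono_ideal A"
  then have "Poly_Mapping.single 0 (lookup f \<alpha>) * monomial \<alpha> \<in> I" if "\<alpha> \<in> keys f" for \<alpha>
    using that assms by (intro ideal.subspace_scale) (auto simp: mono_ideal_iff)
  then show "f \<in> I"
    by (subst poly_eq_sum_monomials) (intro ideal.subspace_sum assms)
qed

lemma span_monomials:
  "ideal.span (monomial ` A) = mono_ideal {\<alpha> + \<beta> |\<alpha> \<beta>. \<alpha> \<in> A}" (is "_ = mono_ideal ?U")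
proof
  have "up_closed ?U"
    by (fastforce simp: up_closed_def add.assoc)
  moreover have "A \<subseteq> ?U"
    by (metis (mono_tags, lifting) add.right_neutral mem_Collect_eq subsetI)
  ultimately show "ideal.span (monomial ` A) \<subseteq> mono_ideal ?U"
    by (intro ideal.span_minimal subspace_mono_ideal) (auto simp del: mem_Collect_eq)
  have "monomial (\<alpha> + \<beta>) \<in> ideal.span (monomial ` A)" if "\<alpha> \<in> A" for \<alpha> \<beta>
  proof -
    have "monomial \<beta> * monomial \<alpha> \<in> ideal.span (monomial ` A)"
      using that by (intro ideal.span_scale ideal.span_base) auto
    then show ?thesis
      by (simp add: monomial_def mult_single add.commute)
  qed
  then show "mono_ideal ?U \<subseteq> ideal.span (monomial ` A)"
    by (intro mono_ideal_subset) auto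
qed

lemma monomial_ideal_mono_ideal:
  assumes "up_closed A"
  shows "monomial_ideal (mono_ideal A)"
proof -
  have "{\<alpha> + \<beta> |\<alpha> \<beta>. \<alpha> \<in> A} = A"
    using assms by (auto simp: up_closed_def) (metis add.right_neutral)
  then show ?thesis
    unfolding monomial_ideal_def using span_monomials[of A] by metis
qed

lemma monomial_idealE:
  assumes "monomial_ideal I"
  obtains A where "up_closed A" "I = mono_ideal A"
proof -
  from assms obtain A where "I = ideal.span (monomial ` A)"
    by (auto simp: monomial_ideal_def)
  then have "I = mono_ideal {\<alpha> + \<beta> |\<alpha> \<beta>. \<alpha> \<in> A}"
    by (simp add: span_monomials)
  moreover have "up_closed {\<alpha> + \<beta> |\<alpha> \<beta>. \<alpha> \<in> A}"
    by (fastforce simp: up_closed_def add.assoc)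
  ultimately show ?thesis
    using that by blast
qed

section \<open>Powers of monomial ideals\<close>

primrec exponent_power :: "('n \<Rightarrow>\<^sub>0 nat) set \<Rightarrow> nat \<Rightarrow> ('n \<Rightarrow>\<^sub>0 nat) set" where
  "exponent_power A 0 = UNIV"
| "exponent_power A (Suc m) = {\<alpha> + \<beta> |\<alpha> \<beta>. \<alpha> \<in> A \<and> \<beta> \<in> exponent_power A m}"

text \<open>Since the recursion starts from \<open>UNIV\<close>, the elements are sums of
  \<open>m\<close> members of \<open>A\<close> plus an arbitrary vector, whatever \<open>A\<close>
  is.\<close>

lemma up_closed_exponent_power: "up_closed (exponent_power A m)"
proof (induction m)
  case (Suc m)
  then show ?case
    by (fastforce simp: up_closed_def add.assoc)
qed (simp add: up_closed_def)

lemma exponent_power_Suc: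
  "\<alpha> \<in> A \<Longrightarrow> \<beta> \<in> exponent_power A m \<Longrightarrow> \<alpha> + \<beta> \<in> exponent_power A (Suc m)"
  by auto

lemma exponent_power_mono: "A \<subseteq> B \<Longrightarrow> exponent_power A m \<subseteq> exponent_power B m"
  by (induction m) fastforce+

lemma ideal_power_mono_ideal:
  "ideal_power (mono_ideal A :: ('n, 'k::comm_ring_1) mpoly set) m = mono_ideal (exponent_power A m)"
proof (induction m)
  case (Suc m)
  let ?S = "{a * b |a b. a \<in> (mono_ideal A :: ('n, 'k) mpoly set) \<and> b \<in> mono_ideal (exponent_power A m)}"
  have "ideal.span ?S \<subseteq> mono_ideal (exponent_power A (Suc m))"
  proof (intro ideal.span_minimal subspace_mono_ideal up_closed_exponent_power)
    show "?S \<subseteq> mono_ideal (exponent_power A (Suc m))"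
      using mult_in_mono_ideal by fastforce
  qed
  moreover have "mono_ideal (exponent_power A (Suc m)) \<subseteq> ideal.span ?S"
  proof (intro mono_ideal_subset ideal.subspace_span image_subsetI)
    fix \<gamma> assume "\<gamma> \<in> exponent_power A (Suc m)"
    then obtain \<alpha> \<beta> where "\<gamma> = \<alpha> + \<beta>" "\<alpha> \<in> A" "\<beta> \<in> exponent_power A m"
      by auto
    then have "monomial \<gamma> = (monomial \<alpha> * monomial \<beta> :: ('n, 'k) mpoly)"
      and "(monomial \<alpha> :: ('n, 'k) mpoly) \<in> mono_ideal A"
      and "(monomial \<beta> :: ('n, 'k) mpoly) \<in> mono_ideal (exponent_power A m)"
      by (simp_all add: monomial_def[of "_ :: 'n \<Rightarrow>\<^sub>0 nat"] mult_single mono_ideal_iff)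
    then show "monomial \<gamma> \<in> ideal.span ?S"
      by (intro ideal.span_base) blast
  qed
  ultimately show ?case
    by (simp add: Suc.IH)
qed simp

text \<open>Serves for automorphisms of the ring and, with the identity as \<open>\<phi>\<close>,
  for monotonicity of powers.\<close>

lemma ideal_power_hom:
  fixes \<phi> :: "'a::comm_ring_1 \<Rightarrow> 'b::comm_ring_1"
  assumes add: "\<And>x y. \<phi> (x + y) = \<phi> x + \<phi> y" and mult: "\<And>x y. \<phi> (x * y) = \<phi> x * \<phi> y"
    and sub: "\<And>x. x \<in> I \<Longrightarrow> \<phi> x \<in> J"
  shows "x \<in> ideal_power I m \<Longrightarrow> \<phi> x \<in> ideal_power J m"
proof (induction m arbitrary: x)
  case (Suc m)
  have zero: "\<phi> 0 = 0"
    using add[of 0 0] by simp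
  from Suc.prems have "x \<in> ideal.span {a * b |a b. a \<in> I \<and> b \<in> ideal_power I m}"
    by simp
  then show ?case
  proof (induction rule: ideal.span_induct_alt)
    case base
    then show ?case
      by (simp add: zero ideal.span_zero)
  next
    case (step c x y)
    then obtain a b where "x = a * b" "a \<in> I" "b \<in> ideal_power I m"
      by auto
    then have "\<phi> x \<in> ideal.span {a * b |a b. a \<in> J \<and> b \<in> ideal_power J m}"
      by (intro ideal.span_base) (auto simp: mult intro!: sub Suc.IH)
    with step show ?case
      by (auto simp: mult add intro: ideal.span_add ideal.span_scale)
  qed
qed simp

lemma integral_closure_hom:
  fixes \<phi> :: "'a::comm_ring_1 \<Rightarrow> 'b::comm_ring_1"
  assumes add: "\<And>x y. \<phi> (x + y) = \<phi> x + \<phi> y" and mult: "\<And>x y. \<phi> (x * y) = \<phi> x * \<phi> y"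
    and one: "\<phi> 1 = 1"
    and sub: "\<And>x. x \<in> I \<Longrightarrow> \<phi> x \<in> J"
    and f: "f \<in> integral_closure I"
  shows "\<phi> f \<in> integral_closure J"
proof -
  interpret additive \<phi>
    by standard (rule add)
  have pow: "\<phi> (x ^ n) = \<phi> x ^ n" for x n
    by (induction n) (simp_all add: one mult)
  from f obtain m a where m: "m \<ge> 1" and a: "\<forall>i\<in>{1..m}. a i \<in> ideal_power I i"
    and "f ^ m + (\<Sum>i = 1..m. a i * f ^ (m - i)) = 0"
    by (auto simp: integral_closure_def)
  then have "\<phi> (f ^ m + (\<Sum>i = 1..m. a i * f ^ (m - i))) = 0"
    by (simp only: zero)
  then have "\<phi> f ^ m + (\<Sum>i = 1..m. \<phi> (a i) * \<phi> f ^ (m - i)) = 0"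
    by (simp only: add mult pow sum)
  moreover have "\<forall>i\<in>{1..m}. \<phi> (a i) \<in> ideal_power J i"
    using a ideal_power_hom[OF add mult sub] by blast
  ultimately show ?thesis
    using m unfolding integral_closure_def
    by (intro CollectI exI[of _ m] exI[of _ "\<lambda>i. \<phi> (a i)"] conjI)
qed

text \<open>The equation has degree one with coefficient \<open>-f\<close>, written as
  \<open>f * (- 1)\<close> to match a generator of \<open>ideal_power I 1\<close>.\<close>

lemma subset_integral_closure: "I \<subseteq> integral_closure I"
proof
  fix f assume "f \<in> I"
  then have "f * (- 1) \<in> ideal_power I 1"
    unfolding One_nat_def ideal_power.simps by (intro ideal.span_base) blast
  then show "f \<in> integral_closure I"
    unfolding integral_closure_def
    by (intro CollectI exI[of _ "1::nat"] exI[of _ "\<lambda>_. f * (- 1)"]) auto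
qed

lemma integrally_closedI: "integral_closure I \<subseteq> I \<Longrightarrow> integrally_closed I"
  using subset_integral_closure by (auto simp: integrally_closed_def)

section \<open>Monomial valuations\<close>

definition weight_ge :: "(('n \<Rightarrow>\<^sub>0 nat) \<Rightarrow> nat) \<Rightarrow> nat \<Rightarrow> ('n \<Rightarrow>\<^sub>0 nat) set" where
  "weight_ge w c = {\<alpha>. c \<le> w \<alpha>}"

text \<open>An additive \<open>w\<close> is a linear form with nonnegative coefficients on the
  exponents, that is, a monomial valuation.\<close>

locale weight =
  fixes w :: "('n::{finite, linorder} \<Rightarrow>\<^sub>0 nat) \<Rightarrow> nat"
  assumes weight_add: "w (\<alpha> + \<beta>) = w \<alpha> + w \<beta>"
begin

lemma weight_0 [simp]: "w 0 = 0"
  using weight_add[of 0 0] by simp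

lemma up_closed_weight_ge: "up_closed (weight_ge w c)"
  by (auto simp: up_closed_def weight_ge_def weight_add)

lemma weight_ge_mult:
  "f \<in> mono_ideal (weight_ge w c) \<Longrightarrow> g \<in> mono_ideal (weight_ge w d) \<Longrightarrow>
   f * g \<in> mono_ideal (weight_ge w (c + d))"
  using mult_in_mono_ideal[of f "weight_ge w c" g "weight_ge w d"]
  by (auto simp: mono_ideal_iff weight_ge_def weight_add)

lemma weight_ge_power:
  "f \<in> mono_ideal (weight_ge w c) \<Longrightarrow> f ^ m \<in> mono_ideal (weight_ge w (m * c))"
  by (induction m) (auto simp: weight_ge_mult, simp add: weight_ge_def mono_ideal_def)

lemma weight_ge_antimono:
  "f \<in> mono_ideal (weight_ge w c) \<Longrightarrow> d \<le> c \<Longrightarrow> f \<in> mono_ideal (weight_ge w d)"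
  by (force simp: mono_ideal_iff weight_ge_def)

lemma exponent_power_weight_ge:
  "A \<subseteq> weight_ge w c \<Longrightarrow> exponent_power A m \<subseteq> weight_ge w (m * c)"
proof (induction m)
  case (Suc m)
  then show ?case
    by (fastforce simp: weight_ge_def weight_add intro: add_mono)
qed (simp add: weight_ge_def)

lemma ideal_power_weight_ge:
  assumes "I \<subseteq> mono_ideal (weight_ge w c)"
  shows "ideal_power I m \<subseteq> mono_ideal (weight_ge w (m * c))"
proof
  fix f assume "f \<in> ideal_power I m"
  then have "f \<in> ideal_power (mono_ideal (weight_ge w c)) m"
    using assms ideal_power_hom[of "\<lambda>x. x" I "mono_ideal (weight_ge w c)" f m] by auto
  then show "f \<in> mono_ideal (weight_ge w (m * c))"
    using mono_ideal_mono[OF exponent_power_weight_ge[OF order.refl]]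
    by (auto simp: ideal_power_mono_ideal)
qed

text \<open>The order of a polynomial with respect to a weight is a valuation, because the ring has no
  zero divisors: the form of lowest weight of \<open>f ^ m\<close> is the \<open>m\<close>-th power of that of \<open>f\<close>.\<close>

lemma integral_closure_weight_ge:
  fixes I :: "('n, 'k::idom) mpoly set"
  assumes I: "I \<subseteq> mono_ideal (weight_ge w c)"
  shows "integral_closure I \<subseteq> mono_ideal (weight_ge w c)"
proof
  fix f assume "f \<in> integral_closure I"
  then obtain m a where m: "m \<ge> 1" and a: "\<forall>i\<in>{1..m}. a i \<in> ideal_power I i"
    and eq: "f ^ m + (\<Sum>i = 1..m. a i * f ^ (m - i)) = 0"
    by (auto simp: integral_closure_def)
  show "f \<in> mono_ideal (weight_ge w c)"
  proof (rule ccontr)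
    assume "f \<notin> mono_ideal (weight_ge w c)"
    then obtain \<alpha> where \<alpha>: "\<alpha> \<in> keys f" "w \<alpha> < c"
      by (auto simp: mono_ideal_iff weight_ge_def subset_iff not_le)
    define v where "v = Min (w ` keys f)"
    have min: "v \<le> w \<beta>" if "\<beta> \<in> keys f" for \<beta>
      using that by (simp add: v_def)
    have "v < c"
      using min[OF \<alpha>(1)] \<alpha>(2) by simp
    have v: "v \<in> w ` keys f"
      using \<alpha>(1) unfolding v_def by (intro Min_in) auto
    let ?V = "\<lambda>d. mono_ideal (weight_ge w d) :: ('n, 'k) mpoly set"
    note sub = subspace_mono_ideal[OF up_closed_weight_ge]
    define f0 where "f0 = (\<Sum>\<beta>\<in>{\<beta>\<in>keys f. w \<beta> = v}. Poly_Mapping.single \<beta> (lookup f \<beta>))"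
    have f0: "lookup f0 \<beta> = (if w \<beta> = v then lookup f \<beta> else 0)" for \<beta>
      by (auto simp: f0_def lookup_sum lookup_single when_def not_in_keys_iff_lookup_eq_zero)
    have keys_f0: "w \<beta> = v" if "\<beta> \<in> keys f0" for \<beta>
      using that by (auto simp: in_keys_iff f0 split: if_splits)
    have "f0 \<noteq> 0"
    proof
      assume "f0 = 0"
      then have "lookup f0 \<beta> = 0" for \<beta>
        by simp
      moreover obtain \<beta> where "\<beta> \<in> keys f" "w \<beta> = v"
        using v by auto
      ultimately show False
        by (metis f0 in_keys_iff)
    qed
    then have f0_pow: "f0 ^ m \<noteq> 0"
      by simp
    have f: "f \<in> ?V v"
      using min by (auto simp: mono_ideal_iff weight_ge_def)
    have diff: "f - f0 \<in> ?V (Suc v)"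
    proof -
      have "Suc v \<le> w \<beta>" if "\<beta> \<in> keys (f - f0)" for \<beta>
      proof -
        have "lookup f \<beta> \<noteq> lookup f0 \<beta>"
          using that by (auto simp: in_keys_iff lookup_minus)
        then have "w \<beta> \<noteq> v" "\<beta> \<in> keys f"
          by (auto simp: f0 in_keys_iff split: if_splits)
        then show ?thesis
          using min[of \<beta>] by simp
      qed
      then show ?thesis
        by (auto simp: mono_ideal_iff weight_ge_def)
    qed
    have f0_V: "f0 \<in> ?V v"
      using keys_f0 by (auto simp: mono_ideal_iff weight_ge_def)
    have "f ^ k - f0 ^ k \<in> ?V (Suc (k * v))" for k
    proof (induction k)
      case 0
      show ?case by (simp add: mono_ideal_iff)
    next
      case (Suc k)
      have "f ^ Suc k - f0 ^ Suc k = (f - f0) * f ^ k + f0 * (f ^ k - f0 ^ k)"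
        by (simp add: algebra_simps)
      moreover have "(f - f0) * f ^ k \<in> ?V (Suc (Suc k * v))"
        using weight_ge_mult[OF diff weight_ge_power[OF f, of k]] by simp
      moreover have "f0 * (f ^ k - f0 ^ k) \<in> ?V (Suc (Suc k * v))"
        using weight_ge_mult[OF f0_V Suc.IH] by simp
      ultimately show ?case
        using ideal.subspace_add[OF sub] by metis
    qed
    then have d: "f ^ m - f0 ^ m \<in> ?V (Suc (m * v))" .
    \<comment> \<open>The term has weight at least \<open>i * c + (m - i) * v\<close>, which exceeds
      \<open>m * v\<close> because \<open>v < c\<close> and \<open>i \<ge> 1\<close>.\<close>
    have "a i * f ^ (m - i) \<in> ?V (Suc (m * v))" if "i \<in> {1..m}" for i
    proof -
      have "a i \<in> ?V (i * c)"
        using a that ideal_power_weight_ge[OF I] by blast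
      from weight_ge_mult[OF this weight_ge_power[OF f]]
      have "a i * f ^ (m - i) \<in> ?V (i * c + (m - i) * v)" .
      moreover have "Suc (m * v) \<le> i * c + (m - i) * v"
      proof -
        have "Suc (i * v) \<le> i * c"
          using that \<open>v < c\<close> by (simp add: Suc_le_eq)
        moreover have "m * v = i * v + (m - i) * v"
          using that by (metis add_mult_distrib atLeastAtMost_iff le_add_diff_inverse)
        ultimately show ?thesis by simp
      qed
      ultimately show ?thesis
        by (rule weight_ge_antimono)
    qed
    then have s: "(\<Sum>i = 1..m. a i * f ^ (m - i)) \<in> ?V (Suc (m * v))"
      by (intro ideal.subspace_sum[OF sub])
    have "f0 ^ m = - ((\<Sum>i = 1..m. a i * f ^ (m - i)) + (f ^ m - f0 ^ m))"
      using eq by (simp add: algebra_simps add_eq_0_iff)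
    also have "\<dots> \<in> ?V (Suc (m * v))"
      by (intro ideal.subspace_neg[OF sub] ideal.subspace_add[OF sub] s d)
    finally have "f0 ^ m \<in> ?V (Suc (m * v))" .
    \<comment> \<open>\<open>f0 ^ m\<close> is homogeneous of weight \<open>m * v\<close>, so lying
      in weight at least \<open>m * v + 1\<close> leaves it no monomial.\<close>
    moreover have "w \<beta> = k * v" if "\<beta> \<in> keys (f0 ^ k)" for \<beta> k
      using that
    proof (induction k arbitrary: \<beta>)
      case (Suc k)
      then show ?case
        using keys_mult[of f0 "f0 ^ k"] keys_f0 by (fastforce simp: weight_add)
    qed (simp split: if_splits)
    ultimately have "\<beta> \<notin> keys (f0 ^ m)" for \<beta>
      by (force simp: mono_ideal_iff weight_ge_def)
    then have "keys (f0 ^ m) = {}"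
      by blast
    with f0_pow show False
      by (metis keys_eq_empty)
  qed
qed

end

text \<open>The inequalities pass to \<open>m\<close>-fold sums with bound \<open>m * c\<close> and
  survive integral closure. Hence only \<open>pow\<close> has to be supplied case by case: integer
  points of the dilated region must decompose into \<open>m\<close> elements of \<open>A\<close> and
  a remainder.\<close>

lemma normal_mono_ideal:
  fixes A :: "('n::{finite, linorder} \<Rightarrow>\<^sub>0 nat) set"
  assumes W: "\<And>w c. (w, c) \<in> W \<Longrightarrow> weight w \<and> A \<subseteq> weight_ge w c"
    and pow: "\<And>m. (\<Inter>(w, c)\<in>W. weight_ge w (m * c)) \<subseteq> exponent_power A m"
  shows "normal_ideal (mono_ideal A :: ('n, 'k::idom) mpoly set)"
  unfolding normal_ideal_def
proof (intro allI integrally_closedI)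
  fix m
  have "integral_closure (mono_ideal (exponent_power A m) :: ('n, 'k) mpoly set)
        \<subseteq> mono_ideal (weight_ge w (m * c))" if "(w, c) \<in> W" for w c
  proof -
    interpret weight w
      using W that by blast
    show ?thesis
      using W[OF that] by (intro integral_closure_weight_ge mono_ideal_mono exponent_power_weight_ge) blast
  qed
  then have "integral_closure (mono_ideal (exponent_power A m) :: ('n, 'k) mpoly set)
        \<subseteq> mono_ideal (\<Inter>(w, c)\<in>W. weight_ge w (m * c))"
    by (fastforce simp: mono_ideal_def)
  then show "integral_closure (ideal_power (mono_ideal A) m) \<subseteq> (ideal_power (mono_ideal A) m :: ('n, 'k) mpoly set)"
    using mono_ideal_mono[OF pow, of m] by (auto simp: ideal_power_mono_ideal)
qed

section \<open>Permutations of the variables\<close>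

abbreviation permute :: "('n \<Rightarrow> 'n) \<Rightarrow> ('n \<Rightarrow>\<^sub>0 nat) \<Rightarrow> ('n \<Rightarrow>\<^sub>0 nat)" where
  "permute \<sigma> \<equiv> Poly_Mapping.map_key \<sigma>"

lemma lookup_permute [simp]: "bij \<sigma> \<Longrightarrow> lookup (permute \<sigma> \<alpha>) i = lookup \<alpha> (\<sigma> i)"
  by (simp add: map_key.rep_eq bij_is_inj)

lemma permute_add: "bij \<sigma> \<Longrightarrow> permute \<sigma> (\<alpha> + \<beta>) = permute \<sigma> \<alpha> + permute \<sigma> \<beta>"
  by (simp add: map_key_plus bij_is_inj)

text \<open>\<open>permute \<sigma> \<alpha>\<close> is the composite of \<open>\<alpha>\<close>
  with \<open>\<sigma>\<close>, hence a right action.\<close>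

lemma permute_comp: "bij \<sigma> \<Longrightarrow> bij \<tau> \<Longrightarrow> permute \<tau> (permute \<sigma> \<alpha>) = permute (\<sigma> \<circ> \<tau>) \<alpha>"
  by (simp add: map_key_compose bij_is_inj)

lemma permute_inv [simp]:
  assumes "bij \<sigma>"
  shows "permute \<sigma> (permute (inv \<sigma>) \<alpha>) = \<alpha>" "permute (inv \<sigma>) (permute \<sigma> \<alpha>) = \<alpha>"
  using assms bij_imp_bij_inv[OF assms]
  by (auto intro!: poly_mapping_eqI simp: bij_is_inj bij_is_surj surj_f_inv_f)

lemma inj_permute: "bij \<sigma> \<Longrightarrow> inj (permute \<sigma>)"
  by (metis injI permute_inv(2))

lemma lookup_permute_vars:
  "bij \<sigma> \<Longrightarrow> lookup (permute_vars \<sigma> p) \<alpha> = lookup p (permute \<sigma> \<alpha>)"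
  by (simp add: permute_vars_def map_key.rep_eq inj_permute)

lemma permute_vars_add: "bij \<sigma> \<Longrightarrow> permute_vars \<sigma> (f + g) = permute_vars \<sigma> f + permute_vars \<sigma> g"
  by (simp add: permute_vars_def map_key_plus inj_permute)

lemma permute_vars_single:
  "bij \<sigma> \<Longrightarrow> permute_vars \<sigma> (Poly_Mapping.single \<alpha> c) = Poly_Mapping.single (permute (inv \<sigma>) \<alpha>) c"
  using map_key_single[OF inj_permute, of \<sigma> "permute (inv \<sigma>) \<alpha>" c] by (simp add: permute_vars_def)

lemma permute_vars_1: "bij \<sigma> \<Longrightarrow> permute_vars \<sigma> 1 = 1"
  using permute_vars_single[of \<sigma> 0 1] bij_imp_bij_inv[of \<sigma>] by (simp add: bij_is_inj)

lemma permute_vars_mult: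
  assumes "bij \<sigma>"
  shows "permute_vars \<sigma> (f * g) = permute_vars \<sigma> f * permute_vars \<sigma> g"
proof -
  interpret additive "permute_vars \<sigma>"
    by standard (rule permute_vars_add[OF assms])
  have expand: "h = (\<Sum>\<alpha>\<in>keys h. Poly_Mapping.single \<alpha> (lookup h \<alpha>))" for h :: "('a, 'b) mpoly"
    by (rule poly_mapping_eqI)
       (simp add: lookup_sum lookup_single when_def not_in_keys_iff_lookup_eq_zero)
  have "f * g = (\<Sum>\<alpha>\<in>keys f. \<Sum>\<beta>\<in>keys g. Poly_Mapping.single (\<alpha> + \<beta>) (lookup f \<alpha> * lookup g \<beta>))"
    by (subst expand[of f], subst expand[of g]) (simp add: sum_product mult_single)
  then have "permute_vars \<sigma> (f * g) =
      (\<Sum>\<alpha>\<in>keys f. permute_vars \<sigma> (Poly_Mapping.single \<alpha> (lookup f \<alpha>))) *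
      (\<Sum>\<beta>\<in>keys g. permute_vars \<sigma> (Poly_Mapping.single \<beta> (lookup g \<beta>)))"
    using assms
    by (simp add: sum permute_vars_single permute_add bij_imp_bij_inv sum_product mult_single)
  then show ?thesis
    by (simp only: sum[symmetric] expand[symmetric])
qed

lemma permute_vars_inv:
  "bij \<sigma> \<Longrightarrow> permute_vars \<sigma> (permute_vars (inv \<sigma>) f) = f"
  by (rule poly_mapping_eqI) (simp add: lookup_permute_vars bij_imp_bij_inv)

lemma permute_vars_mono_ideal:
  assumes "bij \<sigma>"
  shows "permute_vars \<sigma> ` mono_ideal A = mono_ideal {\<alpha>. permute \<sigma> \<alpha> \<in> A}"
proof (intro equalityI subsetI)
  fix f assume "f \<in> permute_vars \<sigma> ` mono_ideal A"
  then show "f \<in> mono_ideal {\<alpha>. permute \<sigma> \<alpha> \<in> A}"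
    using assms
    by (force simp: mono_ideal_iff in_keys_iff lookup_permute_vars subset_iff)
next
  fix f assume f: "f \<in> mono_ideal {\<alpha>. permute \<sigma> \<alpha> \<in> A}"
  have "permute_vars (inv \<sigma>) f \<in> mono_ideal A"
    unfolding mono_ideal_iff
  proof
    fix \<alpha> assume "\<alpha> \<in> keys (permute_vars (inv \<sigma>) f)"
    then have "permute (inv \<sigma>) \<alpha> \<in> keys f"
      using assms by (simp add: in_keys_iff lookup_permute_vars bij_imp_bij_inv)
    then show "\<alpha> \<in> A"
      using f assms by (auto simp: mono_ideal_iff)
  qed
  then show "f \<in> permute_vars \<sigma> ` mono_ideal A"
    using permute_vars_inv[OF assms, of f] by (metis imageI)
qed

text \<open>The largest permutation-invariant subset of \<open>A\<close>.\<close>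

definition symmetric_core :: "('n \<Rightarrow>\<^sub>0 nat) set \<Rightarrow> ('n \<Rightarrow>\<^sub>0 nat) set" where
  "symmetric_core A = {\<alpha>. \<forall>\<sigma>. bij \<sigma> \<longrightarrow> permute \<sigma> \<alpha> \<in> A}"

lemma symmetrization_mono_ideal: "symmetrization (mono_ideal A) = mono_ideal (symmetric_core A)"
proof -
  have "symmetrization (mono_ideal A) = (\<Inter>\<sigma>\<in>{\<sigma>. bij \<sigma>}. mono_ideal {\<alpha>. permute \<sigma> \<alpha> \<in> A})"
    unfolding symmetrization_def by (simp add: permute_vars_mono_ideal)
  also have "\<dots> = mono_ideal (symmetric_core A)"
    by (auto simp: mono_ideal_def symmetric_core_def)
  finally show ?thesis .
qed

lemma symmetric_core_subset: "symmetric_core A \<subseteq> A"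
proof
  fix \<alpha> assume "\<alpha> \<in> symmetric_core A"
  then have "permute id \<alpha> \<in> A"
    unfolding symmetric_core_def by blast
  then show "\<alpha> \<in> A"
    by (simp add: map_key_id id_def)
qed

lemma up_closed_symmetric_core: "up_closed A \<Longrightarrow> up_closed (symmetric_core A)"
  by (simp add: up_closed_def symmetric_core_def permute_add)

lemma permute_symmetric_core:
  "bij \<sigma> \<Longrightarrow> \<alpha> \<in> symmetric_core A \<Longrightarrow> permute \<sigma> \<alpha> \<in> symmetric_core A"
  by (simp add: symmetric_core_def permute_comp bij_comp)

lemma integrally_closed_symmetrization:
  assumes "integrally_closed J"
  shows "integrally_closed (symmetrization J)"
proof (intro integrally_closedI subsetI)
  fix f assume f: "f \<in> integral_closure (symmetrization J)"
  have "f \<in> permute_vars \<sigma> ` J" if \<sigma>: "bij \<sigma>" for \<sigma>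
  proof -
    have inv: "bij (inv \<sigma>)"
      using \<sigma> by (rule bij_imp_bij_inv)
    have "permute_vars (inv \<sigma>) g \<in> J" if g: "g \<in> symmetrization J" for g
    proof -
      obtain h where "g = permute_vars \<sigma> h" "h \<in> J"
        using g \<sigma> unfolding symmetrization_def by blast
      then show ?thesis
        using permute_vars_inv[OF inv, of h] \<sigma> by (simp add: inv_inv_eq)
    qed
    from integral_closure_hom[OF permute_vars_add[OF inv] permute_vars_mult[OF inv] permute_vars_1[OF inv] this f]
    have "permute_vars (inv \<sigma>) f \<in> J"
      using assms by (simp add: integrally_closed_def)
    then show ?thesis
      using permute_vars_inv[OF \<sigma>, of f] by (metis imageI)
  qed
  then show "f \<in> symmetrization J"
    by (simp add: symmetrization_def)
qed

lemma lookup_shift: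
  assumes "i \<noteq> j"
  shows "lookup (shift \<alpha> i j) k =
    (if k = i then lookup \<alpha> i + 1 else if k = j then lookup \<alpha> j - 1 else lookup \<alpha> k)"
  using assms by (simp add: shift_def lookup_add lookup_minus lookup_single when_def)

lemma permute_shift:
  assumes "bij \<sigma>" "i \<noteq> j"
  shows "permute \<sigma> (shift \<alpha> (\<sigma> i) (\<sigma> j)) = shift (permute \<sigma> \<alpha>) i j"
proof (rule poly_mapping_eqI)
  fix k
  have "\<sigma> k = \<sigma> l \<longleftrightarrow> k = l" for k l
    using assms(1) by (auto simp: bij_def inj_eq)
  with assms show "lookup (permute \<sigma> (shift \<alpha> (\<sigma> i) (\<sigma> j))) k = lookup (shift (permute \<sigma> \<alpha>) i j) k"
    by (simp add: lookup_shift)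
qed

lemma shift_add:
  assumes "i \<noteq> j" "lookup \<alpha> j \<noteq> 0"
  shows "shift \<alpha> i j + Poly_Mapping.single j 1 = \<alpha> + Poly_Mapping.single i 1"
  using assms
  by (intro poly_mapping_eqI) (auto simp: lookup_shift lookup_add lookup_single when_def)

lemma shift_add_left:
  assumes "i \<noteq> j" "lookup \<alpha> j \<noteq> 0"
  shows "shift (\<alpha> + \<beta>) i j = shift \<alpha> i j + \<beta>"
  using assms
  by (intro poly_mapping_eqI) (auto simp: lookup_shift lookup_add)

section \<open>Strong stability and symmetric shifting on exponent sets\<close>

definition stable :: "('n::linorder \<Rightarrow>\<^sub>0 nat) set \<Rightarrow> bool" where
  "stable A \<longleftrightarrow> up_closed A \<and>
     (\<forall>\<alpha>\<in>A. \<forall>i j. i < j \<and> lookup \<alpha> j \<noteq> 0 \<longrightarrow> shift \<alpha> i j \<in> A)"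

text \<open>The shift condition covers all vectors and both orders of \<open>i\<close> and
  \<open>j\<close>. Given invariance this is equivalent to the condition on partitions, and it
  applies to the intermediate vectors of the dominance argument, which may fail to be
  sorted.\<close>

definition sym_shifted :: "('n \<Rightarrow>\<^sub>0 nat) set \<Rightarrow> bool" where
  "sym_shifted A \<longleftrightarrow> up_closed A \<and>
     (\<forall>\<sigma>. bij \<sigma> \<longrightarrow> (\<forall>\<alpha>\<in>A. permute \<sigma> \<alpha> \<in> A)) \<and>
     (\<forall>\<alpha>\<in>A. \<forall>i j. lookup \<alpha> i < lookup \<alpha> j \<longrightarrow> shift \<alpha> i j \<in> A)"

lemma stableD:
  assumes "stable A"
  shows "up_closed A" "\<alpha> \<in> A \<Longrightarrow> i < j \<Longrightarrow> lookup \<alpha> j \<noteq> 0 \<Longrightarrow> shift \<alpha> i j \<in> A"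
  using assms by (auto simp: stable_def)

lemma sym_shiftedD:
  assumes "sym_shifted A"
  shows "up_closed A" "bij \<sigma> \<Longrightarrow> permute \<sigma> \<alpha> \<in> A \<longleftrightarrow> \<alpha> \<in> A"
    "\<alpha> \<in> A \<Longrightarrow> lookup \<alpha> i < lookup \<alpha> j \<Longrightarrow> shift \<alpha> i j \<in> A"
  using assms unfolding sym_shifted_def by (blast, metis bij_imp_bij_inv permute_inv(2), blast)

lemma strongly_stable_mono_ideal:
  assumes "up_closed A"
  shows "strongly_stable (mono_ideal A :: ('n::{finite, linorder}, 'k::comm_ring_1) mpoly set) \<longleftrightarrow> stable A"
  using assms monomial_ideal_mono_ideal[OF assms] by (auto simp: strongly_stable_def stable_def)

lemma strongly_stableE:
  assumes "strongly_stable J"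
  obtains A where "stable A" "J = mono_ideal A"
  using assms
  by (metis monomial_idealE strongly_stable_def strongly_stable_mono_ideal)

lemma partitionsD: "\<mu> \<in> partitions \<Longrightarrow> i \<le> j \<Longrightarrow> lookup \<mu> i \<le> lookup \<mu> j"
  by (simp add: partitions_def mono_def)

text \<open>The lexicographically least rearrangement is increasing, since swapping an inversion
  would make it smaller.\<close>

lemma sorting_permutation:
  fixes \<alpha> :: "'n::{finite, linorder} \<Rightarrow>\<^sub>0 nat"
  obtains \<sigma> where "bij \<sigma>" "permute \<sigma> \<alpha> \<in> partitions"
proof -
  let ?S = "(\<lambda>\<sigma>. permute \<sigma> \<alpha>) ` {\<sigma>. bij \<sigma>}"
  have "finite ?S" "?S \<noteq> {}"
    by (auto intro: bij_id)
  then have "Min ?S \<in> ?S"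
    by (rule Min_in)
  then obtain \<sigma> where \<sigma>: "bij \<sigma>" "Min ?S = permute \<sigma> \<alpha>"
    by auto
  have "lookup (permute \<sigma> \<alpha>) i \<le> lookup (permute \<sigma> \<alpha>) j" if "i \<le> j" for i j
  proof (rule ccontr)
    assume gt: "\<not> lookup (permute \<sigma> \<alpha>) i \<le> lookup (permute \<sigma> \<alpha>) j"
    define \<tau> where "\<tau> = \<sigma> \<circ> id(i := j, j := i)"
    have swap: "bij (id(i := j, j := i))"
      by (rule o_bij[of "id(i := j, j := i)"]) auto
    then have "bij \<tau>"
      unfolding \<tau>_def using \<sigma>(1) by (rule bij_comp)
    have "i < j"
      using gt that by (cases "i = j") auto
    have "permute \<tau> \<alpha> < permute \<sigma> \<alpha>"
      unfolding exponent_less_iff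
      by (rule exI[of _ i]) (use gt \<open>i < j\<close> \<open>bij \<tau>\<close> \<sigma>(1) in \<open>auto simp: \<tau>_def\<close>)
    moreover have "Min ?S \<le> permute \<tau> \<alpha>"
      using \<open>finite ?S\<close> \<open>bij \<tau>\<close> by (intro Min_le) auto
    ultimately show False
      using \<sigma>(2) by simp
  qed
  with \<sigma>(1) that show ?thesis
    by (auto simp: partitions_def mono_def)
qed

text \<open>A shift of an arbitrary vector is carried over to its sorted rearrangement, where the
  strict inequality of the two entries forces the order of their positions.\<close>

lemma symmetric_strongly_shifted_mono_ideal:
  fixes A :: "('n::{finite, linorder} \<Rightarrow>\<^sub>0 nat) set"
  assumes up: "up_closed A"
  shows "symmetric_strongly_shifted (mono_ideal A :: ('n, 'k::comm_ring_1) mpoly set) \<longleftrightarrow> sym_shifted A"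
proof
  assume sss: "symmetric_strongly_shifted (mono_ideal A :: ('n, 'k) mpoly set)"
  have perm: "permute \<sigma> \<alpha> \<in> A \<longleftrightarrow> \<alpha> \<in> A" if "bij \<sigma>" for \<sigma> \<alpha>
  proof -
    have "(mono_ideal {\<alpha>. permute \<sigma> \<alpha> \<in> A} :: ('n, 'k) mpoly set) = mono_ideal A"
      using sss that by (simp add: symmetric_strongly_shifted_def symmetric_ideal_def flip: permute_vars_mono_ideal)
    then have "(monomial \<alpha> :: ('n, 'k) mpoly) \<in> mono_ideal {\<alpha>. permute \<sigma> \<alpha> \<in> A} \<longleftrightarrow>
        (monomial \<alpha> :: ('n, 'k) mpoly) \<in> mono_ideal A"
      by simp
    then show ?thesis by simp
  qed
  have "shift \<alpha> i j \<in> A" if \<alpha>: "\<alpha> \<in> A" and less: "lookup \<alpha> i < lookup \<alpha> j" for \<alpha> i j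
  proof -
    obtain \<sigma> where \<sigma>: "bij \<sigma>" "permute \<sigma> \<alpha> \<in> partitions"
      by (rule sorting_permutation)
    obtain p q where p: "i = \<sigma> p" and q: "j = \<sigma> q"
      using \<sigma>(1) by (metis bij_pointE)
    have *: "lookup (permute \<sigma> \<alpha>) p < lookup (permute \<sigma> \<alpha>) q"
      using less p q \<sigma>(1) by simp
    then have "p < q"
      using partitionsD[OF \<sigma>(2), of q p] by force
    moreover have "permute \<sigma> \<alpha> \<in> partitions_of (mono_ideal A :: ('n, 'k) mpoly set)"
      using \<sigma> \<alpha> by (simp add: partitions_of_def perm)
    ultimately have "shift (permute \<sigma> \<alpha>) p q \<in> A"
      using sss * unfolding symmetric_strongly_shifted_def by fastforce
    then have "permute \<sigma> (shift \<alpha> i j) \<in> A"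
      using \<open>p < q\<close> by (simp add: p q permute_shift[OF \<sigma>(1)])
    then show ?thesis
      using \<sigma>(1) by (simp add: perm)
  qed
  with up perm show "sym_shifted A"
    by (simp add: sym_shifted_def)
next
  assume A: "sym_shifted A"
  then show "symmetric_strongly_shifted (mono_ideal A :: ('n, 'k) mpoly set)"
    using monomial_ideal_mono_ideal[OF up] subspace_mono_ideal[OF up]
    by (simp add: symmetric_strongly_shifted_def symmetric_ideal_def permute_vars_mono_ideal
        sym_shiftedD(2,3) partitions_of_def)
qed

lemma symmetric_strongly_shiftedE:
  assumes "symmetric_strongly_shifted I"
  obtains A where "sym_shifted A" "I = mono_ideal A"
  using assms
  by (metis monomial_idealE symmetric_strongly_shifted_def symmetric_strongly_shifted_mono_ideal)

lemma exponent_power_SucE: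
  assumes "\<gamma> \<in> exponent_power A (Suc m)"
  obtains \<alpha> \<beta> where "\<gamma> = \<alpha> + \<beta>" "\<alpha> \<in> A" "\<beta> \<in> exponent_power A m"
  using assms by auto

text \<open>A shift of a sum can be performed inside a summand in which the variable
  \<open>j\<close> occurs.\<close>

lemma stable_exponent_power:
  assumes "stable A"
  shows "stable (exponent_power A m)"
proof (induction m)
  case 0
  then show ?case by (simp add: stable_def up_closed_def)
next
  case (Suc m)
  have "shift (\<alpha> + \<beta>) i j \<in> exponent_power A (Suc m)"
    if \<alpha>: "\<alpha> \<in> A" and \<beta>: "\<beta> \<in> exponent_power A m" and "i < j" "lookup (\<alpha> + \<beta>) j \<noteq> 0" for \<alpha> \<beta> i j
  proof (cases "lookup \<alpha> j = 0")
    case False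
    then show ?thesis
      using that exponent_power_Suc[OF stableD(2)[OF assms \<alpha>, of i j] \<beta>] by (simp add: shift_add_left)
  next
    case True
    then have "lookup \<beta> j \<noteq> 0"
      using that by (simp add: lookup_add)
    then show ?thesis
      using that exponent_power_Suc[OF \<alpha> stableD(2)[OF Suc \<beta>, of i j]]
        shift_add_left[of i j \<beta> \<alpha>] by (simp add: add.commute)
  qed
  then show ?case
    using up_closed_exponent_power[of A "Suc m"] by (auto simp: stable_def)
qed

text \<open>If the entries of a sum satisfy the strict inequality, then so do those of one of the
  two summands, and the shift is performed there.\<close>

lemma sym_shifted_exponent_power:
  assumes "sym_shifted A"
  shows "sym_shifted (exponent_power A m)"
proof (induction m)
  case 0
  then show ?case by (simp add: sym_shifted_def up_closed_def)
next
  case (Suc m)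
  have "shift (\<alpha> + \<beta>) i j \<in> exponent_power A (Suc m)"
    if \<alpha>: "\<alpha> \<in> A" and \<beta>: "\<beta> \<in> exponent_power A m" and less: "lookup (\<alpha> + \<beta>) i < lookup (\<alpha> + \<beta>) j" for \<alpha> \<beta> i j
  proof (cases "lookup \<alpha> i < lookup \<alpha> j")
    case True
    then show ?thesis
      using less exponent_power_Suc[OF sym_shiftedD(3)[OF assms \<alpha>, of i j] \<beta>]
      by (subst shift_add_left) auto
  next
    case False
    then have "lookup \<beta> i < lookup \<beta> j"
      using less by (simp add: lookup_add)
    moreover from this have "shift (\<alpha> + \<beta>) i j = \<alpha> + shift \<beta> i j"
      using shift_add_left[of i j \<beta> \<alpha>] by (auto simp: add.commute)
    ultimately show ?thesis
      using exponent_power_Suc[OF \<alpha> sym_shiftedD(3)[OF Suc \<beta>, of i j]] by simp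
  qed
  moreover have "permute \<sigma> (\<alpha> + \<beta>) \<in> exponent_power A (Suc m)"
    if "\<alpha> \<in> A" "\<beta> \<in> exponent_power A m" "bij \<sigma>" for \<alpha> \<beta> \<sigma>
    using that exponent_power_Suc[of "permute \<sigma> \<alpha>" A "permute \<sigma> \<beta>"]
    by (simp add: permute_add sym_shiftedD(2)[OF assms] sym_shiftedD(2)[OF Suc])
  ultimately show ?case
    using up_closed_exponent_power[of A "Suc m"] unfolding sym_shifted_def
    by (intro conjI allI impI ballI) (simp, (elim exponent_power_SucE, simp)+)
qed

lemma stable_iterated_shift:
  assumes A: "stable A" and \<alpha>: "\<alpha> \<in> A" and "i < j" and t: "t \<le> lookup \<alpha> j"
    and \<beta>: "lookup \<beta> = (lookup \<alpha>)(i := lookup \<alpha> i + t, j := lookup \<alpha> j - t)"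
  shows "\<beta> \<in> A"
  using t \<beta>
proof (induction t arbitrary: \<beta>)
  case 0
  then have "\<beta> = \<alpha>"
    by (intro poly_mapping_eqI) simp
  with \<alpha> show ?case by simp
next
  case (Suc t)
  \<comment> \<open>The last of the \<open>t + 1\<close> shifts is undone to reach the induction
    hypothesis.\<close>
  define \<gamma> where "\<gamma> = shift \<beta> j i"
  have \<gamma>: "lookup \<gamma> = (lookup \<alpha>)(i := lookup \<alpha> i + t, j := lookup \<alpha> j - t)"
    using Suc.prems \<open>i < j\<close> by (auto simp: \<gamma>_def lookup_shift fun_eq_iff)
  moreover from this have "\<beta> = shift \<gamma> i j"
    using Suc.prems \<open>i < j\<close> by (intro poly_mapping_eqI) (auto simp: lookup_shift)
  moreover from calculation have "\<gamma> \<in> A"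
    using Suc.IH[OF _ \<gamma>] Suc.prems(1) by linarith
  moreover from calculation have "lookup \<gamma> j \<noteq> 0"
    using Suc.prems(1) by simp
  ultimately show ?case
    using stableD(2)[OF A, of \<gamma> i j] \<open>i < j\<close> by simp
qed

text \<open>Stability only moves exponents towards earlier variables. A shift in the opposite
  direction is obtained by swapping the two entries first and then moving most of their difference
  back.\<close>

lemma sym_shifted_symmetric_core:
  assumes A: "stable A"
  shows "sym_shifted (symmetric_core A)"
proof -
  have "shift \<alpha> i j \<in> A" if \<alpha>: "\<alpha> \<in> symmetric_core A" and less: "lookup \<alpha> i < lookup \<alpha> j" for \<alpha> i j
  proof (cases "i < j")
    case True
    then show ?thesis
      using less \<alpha> symmetric_core_subset[of A] by (intro stableD(2)[OF A]) auto
  next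
    case False
    with less have "j < i"
      by (cases "i = j") auto
    \<comment> \<open>After the swap, moving
      \<open>lookup \<alpha> j - lookup \<alpha> i - 1\<close> units from \<open>i\<close> to
      \<open>j\<close> leaves \<open>lookup \<alpha> j - 1\<close> at \<open>j\<close> and
      \<open>lookup \<alpha> i + 1\<close> at \<open>i\<close>, which is the desired shift.\<close>
    let ?\<tau> = "id(i := j, j := i)"
    have "bij ?\<tau>"
      by (rule o_bij[of ?\<tau>]) auto
    then have "permute ?\<tau> \<alpha> \<in> A"
      using \<alpha> by (simp add: symmetric_core_def)
    then show ?thesis
      by (rule stable_iterated_shift[OF A _ \<open>j < i\<close>, of _ "lookup \<alpha> j - lookup \<alpha> i - 1"])
         (use less \<open>j < i\<close> \<open>bij ?\<tau>\<close> in \<open>auto simp: lookup_shift fun_eq_iff\<close>)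
  qed
  note in_A = this
  have "shift \<alpha> i j \<in> symmetric_core A"
    if \<alpha>: "\<alpha> \<in> symmetric_core A" and less: "lookup \<alpha> i < lookup \<alpha> j" for \<alpha> i j
    unfolding symmetric_core_def
  proof (intro CollectI allI impI)
    fix \<sigma> :: "'a \<Rightarrow> 'a" assume \<sigma>: "bij \<sigma>"
    obtain p q where p: "i = \<sigma> p" and q: "j = \<sigma> q"
      using \<sigma> by (metis bij_pointE)
    have "shift (permute \<sigma> \<alpha>) p q \<in> A"
      using less \<sigma> by (intro in_A permute_symmetric_core \<alpha>) (auto simp: p q)
    moreover have "p \<noteq> q"
      using less by (auto simp: p q)
    ultimately show "permute \<sigma> (shift \<alpha> i j) \<in> A"
      by (simp add: p q permute_shift[OF \<sigma>])
  qed
  with stableD(1)[OF A] show ?thesis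
    by (simp add: sym_shifted_def up_closed_symmetric_core permute_symmetric_core)
qed

section \<open>The dominance order\<close>

definition psum :: "('n::{finite, linorder} \<Rightarrow>\<^sub>0 nat) \<Rightarrow> 'n \<Rightarrow> nat" where
  "psum \<alpha> k = (\<Sum>i\<le>k. lookup \<alpha> i)"

lemma psum_add: "psum (\<alpha> + \<beta>) k = psum \<alpha> k + psum \<beta> k"
  by (simp add: psum_def lookup_add sum.distrib)

lemma psum_mono: "i \<le> k \<Longrightarrow> psum \<alpha> i \<le> psum \<alpha> k"
  unfolding psum_def by (intro sum_mono2) auto

lemma psum_single: "psum (Poly_Mapping.single i (Suc 0)) k = (if i \<le> k then 1 else 0)"
  by (simp add: psum_def lookup_single when_def)

lemma psum_shift:
  assumes "i < j" "lookup \<alpha> j \<noteq> 0"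
  shows "psum (shift \<alpha> i j) k = psum \<alpha> k + (if i \<le> k \<and> k < j then 1 else 0)"
proof -
  have "psum (shift \<alpha> i j + Poly_Mapping.single j 1) k = psum (\<alpha> + Poly_Mapping.single i 1) k"
    using shift_add[of i j \<alpha>] assms by auto
  then show ?thesis
    using \<open>i < j\<close> by (auto simp: psum_add psum_single split: if_splits)
qed

lemma psum_eq_sum_less: "psum \<alpha> k = (\<Sum>i<k. lookup \<alpha> i) + lookup \<alpha> k"
proof -
  have "{..k} = insert k {..<k}"
    by auto
  then show ?thesis
    by (simp add: psum_def)
qed

text \<open>The index type is an abstract finite order; \<open>p\<close> is the predecessor of
  \<open>k\<close>, found as a maximum.\<close>

lemma sum_less_eq_psum:
  fixes k :: "'n::{finite, linorder}"
  assumes "i < k"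
  obtains p where "i \<le> p" "p < k" "\<And>\<alpha>. (\<Sum>l<k. lookup \<alpha> l) = psum \<alpha> p"
proof -
  let ?p = "Max {..<k}"
  have "?p \<in> {..<k}"
    using assms by (intro Max_in) auto
  moreover have "l \<le> ?p" if "l < k" for l
    using that by (intro Max_ge) auto
  moreover from calculation have "{..<k} = {..?p}"
    by force
  ultimately show ?thesis
    using that[of ?p] assms by (simp add: psum_def)
qed

lemma sum_less_cong_psum:
  assumes "\<And>l. l < k \<Longrightarrow> psum \<alpha> l = psum \<beta> l"
  shows "(\<Sum>i<k. lookup \<alpha> i) = (\<Sum>i<k. lookup \<beta> i)"
proof (cases "\<exists>i. i < k")
  case True
  then show ?thesis
    using assms by (metis sum_less_eq_psum)
next
  case False
  then have "{..<k} = {}" by auto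
  then show ?thesis by simp
qed

lemma psum_inject:
  assumes "\<And>k. psum \<alpha> k = psum \<beta> k"
  shows "\<alpha> = \<beta>"
proof (rule poly_mapping_eqI)
  fix k
  show "lookup \<alpha> k = lookup \<beta> k"
    using assms[of k] sum_less_cong_psum[of k \<alpha> \<beta>] assms by (simp add: psum_eq_sum_less)
qed

text \<open>Membership in stable sets is passed from the first argument to the second. The last
  partial sum is the degree, which may grow, so divisibility is included.\<close>

definition dominated :: "('n::{finite, linorder} \<Rightarrow>\<^sub>0 nat) \<Rightarrow> ('n \<Rightarrow>\<^sub>0 nat) \<Rightarrow> bool" where
  "dominated \<alpha> \<beta> \<longleftrightarrow> (\<forall>k. psum \<alpha> k \<le> psum \<beta> k)"

lemma dominated_refl [simp]: "dominated \<alpha> \<alpha>"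
  by (simp add: dominated_def)

lemma dominated_trans: "dominated \<alpha> \<beta> \<Longrightarrow> dominated \<beta> \<gamma> \<Longrightarrow> dominated \<alpha> \<gamma>"
  unfolding dominated_def using order_trans by blast

lemma dominated_add: "dominated \<alpha> \<alpha>' \<Longrightarrow> dominated \<beta> \<beta>' \<Longrightarrow> dominated (\<alpha> + \<beta>) (\<alpha>' + \<beta>')"
  by (simp add: dominated_def psum_add add_mono)

text \<open>Climbs from \<open>\<alpha>\<close> towards the fixed \<open>\<beta>\<close>: each
  proper step strictly decreases the total gap between the partial sums, because these determine the
  vector.\<close>

lemma dominated_induct [consumes 1, case_names step]:
  assumes "dominated \<alpha> \<beta>"
    and step: "\<And>\<alpha>. dominated \<alpha> \<beta> \<Longrightarrow>
      (\<And>\<gamma>. dominated \<alpha> \<gamma> \<Longrightarrow> \<gamma> \<noteq> \<alpha> \<Longrightarrow> dominated \<gamma> \<beta> \<Longrightarrow> P \<gamma>) \<Longrightarrow> P \<alpha>"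
  shows "P \<alpha>"
  using assms(1)
proof (induction "\<Sum>k\<in>UNIV. psum \<beta> k - psum \<alpha> k" arbitrary: \<alpha> rule: less_induct)
  case less
  show ?case
  proof (rule step[OF less.prems])
    fix \<gamma> assume \<gamma>: "dominated \<alpha> \<gamma>" "\<gamma> \<noteq> \<alpha>" "dominated \<gamma> \<beta>"
    then obtain k where "psum \<alpha> k \<noteq> psum \<gamma> k"
      using psum_inject by metis
    then have "psum \<beta> k - psum \<gamma> k < psum \<beta> k - psum \<alpha> k"
      using \<gamma> unfolding dominated_def by (metis diff_less_mono2 le_neq_implies_less order_less_le_trans)
    moreover have "psum \<beta> l - psum \<gamma> l \<le> psum \<beta> l - psum \<alpha> l" for l
      using \<gamma> by (simp add: dominated_def diff_le_mono2)
    ultimately have "(\<Sum>k\<in>UNIV. psum \<beta> k - psum \<gamma> k) < (\<Sum>k\<in>UNIV. psum \<beta> k - psum \<alpha> k)"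
      by (intro sum_strict_mono_ex1) auto
    with \<gamma> less.hyps show "P \<gamma>"
      by blast
  qed
qed

text \<open>The shift raises by one exactly the partial sums at positions from \<open>i\<close> up
  to just before \<open>j\<close>, where strict inequality leaves room.\<close>

lemma dominated_shift:
  assumes "dominated \<alpha> \<beta>" "i < j" "lookup \<alpha> j \<noteq> 0"
    and "\<And>k. i \<le> k \<Longrightarrow> k < j \<Longrightarrow> psum \<alpha> k < psum \<beta> k"
  shows "dominated \<alpha> (shift \<alpha> i j)" "shift \<alpha> i j \<noteq> \<alpha>" "dominated (shift \<alpha> i j) \<beta>"
proof -
  have "psum (shift \<alpha> i j) i \<noteq> psum \<alpha> i"
    using assms by (simp add: psum_shift)
  then show "shift \<alpha> i j \<noteq> \<alpha>" by auto
qed (use assms in \<open>auto simp: dominated_def psum_shift Suc_le_eq\<close>)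

lemma dominated_add_single:
  assumes "dominated \<alpha> \<beta>" and "\<And>k. i \<le> k \<Longrightarrow> psum \<alpha> k < psum \<beta> k"
  shows "dominated \<alpha> (\<alpha> + Poly_Mapping.single i 1)" "\<alpha> + Poly_Mapping.single i 1 \<noteq> \<alpha>"
    "dominated (\<alpha> + Poly_Mapping.single i 1) \<beta>"
proof -
  have "psum (\<alpha> + Poly_Mapping.single i 1) i \<noteq> psum \<alpha> i"
    by (simp add: psum_add psum_single)
  then show "\<alpha> + Poly_Mapping.single i 1 \<noteq> \<alpha>" by metis
qed (use assms in \<open>auto simp: dominated_def psum_add psum_single Suc_le_eq\<close>)

lemma ex_least:
  fixes P :: "'n::{finite, linorder} \<Rightarrow> bool"
  assumes "P k"
  obtains i where "P i" "\<And>l. l < i \<Longrightarrow> \<not> P l"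
proof -
  have "Min {i. P i} \<in> {i. P i}"
    using assms by (intro Min_in) auto
  moreover have "Min {i. P i} \<le> l" if "P l" for l
    using that by (intro Min_le) auto
  ultimately show ?thesis
    using that by (metis leD mem_Collect_eq)
qed

text \<open>If \<open>\<alpha>\<close> has a smaller partial sum than \<open>\<beta>\<close> at \<open>i\<close>, the next variable after \<open>i\<close> that occurs
  in \<open>\<alpha>\<close> can be replaced by the \<open>i\<close>-th one; if there is none, \<open>\<alpha>\<close> is multiplied by the \<open>i\<close>-th
  variable.\<close>

lemma stable_dominated:
  assumes "stable A" and "dominated \<alpha> \<beta>" and "\<alpha> \<in> A"
  shows "\<beta> \<in> A"
  using assms(2,3)
proof (induction rule: dominated_induct)
  case (step \<alpha>)
  show ?case
  proof (cases "\<alpha> = \<beta>")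
    case True
    with step show ?thesis by simp
  next
    case False
    then obtain i where i: "psum \<alpha> i < psum \<beta> i"
      using step(1) psum_inject unfolding dominated_def by (metis le_neq_implies_less)
    \<comment> \<open>While no further variable of \<open>\<alpha>\<close> occurs, its partial sums
      stay constant and those of \<open>\<beta>\<close> do not decrease, so the gap at
      \<open>i\<close> persists.\<close>
    have less: "psum \<alpha> k < psum \<beta> k" if "i \<le> k" and zero: "\<And>l. i < l \<Longrightarrow> l \<le> k \<Longrightarrow> lookup \<alpha> l = 0" for k
    proof -
      have "psum \<alpha> k = psum \<alpha> i"
        unfolding psum_def
        using that by (intro sum.mono_neutral_right) (auto simp: not_le)
      also have "\<dots> < psum \<beta> i" by (rule i)
      also have "\<dots> \<le> psum \<beta> k" using \<open>i \<le> k\<close> by (rule psum_mono)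
      finally show ?thesis .
    qed
    show ?thesis
    proof (cases "\<exists>j. i < j \<and> lookup \<alpha> j \<noteq> 0")
      case True
      then obtain j where j: "i < j \<and> lookup \<alpha> j \<noteq> 0" and "\<And>l. l < j \<Longrightarrow> \<not> (i < l \<and> lookup \<alpha> l \<noteq> 0)"
        using ex_least[of "\<lambda>j. i < j \<and> lookup \<alpha> j \<noteq> 0"] by blast
      then have "psum \<alpha> k < psum \<beta> k" if "i \<le> k" "k < j" for k
        using that by (intro less) auto
      from dominated_shift[OF step(1) _ _ this] show ?thesis
        using j step.prems by (intro step.IH[of "shift \<alpha> i j"] stableD(2)[OF assms(1)]) auto
    next
      case False
      then have "psum \<alpha> k < psum \<beta> k" if "i \<le> k" for k
        using that by (intro less) auto
      then show ?thesis
        using dominated_add_single[OF step(1), of i] step.prems up_closedD[OF stableD(1)[OF assms(1)]]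
        by (intro step.IH[of "_ + Poly_Mapping.single i 1"]) blast+
    qed
  qed
qed

text \<open>Here \<open>i\<close> is the first index at which the partial sums differ and \<open>j\<close> the next one at which
  they agree again. Then \<open>\<mu> i < l i \<le> l j < \<mu> j\<close>, so \<open>\<mu>\<close> itself need not be a partition.\<close>

lemma sym_shifted_dominated:
  assumes A: "sym_shifted A" and l: "l \<in> partitions" and "dominated \<mu> l" and "\<mu> \<in> A"
  shows "l \<in> A"
  using assms(3,4)
proof (induction rule: dominated_induct)
  case (step \<mu>)
  show ?case
  proof (cases "\<mu> = l")
    case True
    with step show ?thesis by simp
  next
    case False
    then obtain k where "psum \<mu> k < psum l k"
      using step(1) psum_inject unfolding dominated_def by (metis le_neq_implies_less)
    then obtain i where i: "psum \<mu> i < psum l i" and min: "\<And>k. k < i \<Longrightarrow> \<not> psum \<mu> k < psum l k"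
      using ex_least[of "\<lambda>k. psum \<mu> k < psum l k"] by blast
    have le: "psum \<mu> k \<le> psum l k" for k
      using step(1) by (simp add: dominated_def)
    have "(\<Sum>k<i. lookup \<mu> k) = (\<Sum>k<i. lookup l k)"
      using min le by (intro sum_less_cong_psum) (meson le_neq_implies_less)
    with i have "lookup \<mu> i < lookup l i"
      by (simp add: psum_eq_sum_less)
    show ?thesis
    proof (cases "\<exists>j. i < j \<and> psum \<mu> j = psum l j")
      case True
      then obtain j where j: "i < j \<and> psum \<mu> j = psum l j" and "\<And>k. k < j \<Longrightarrow> \<not> (i < k \<and> psum \<mu> k = psum l k)"
        using ex_least[of "\<lambda>j. i < j \<and> psum \<mu> j = psum l j"] by blast
      then have less: "psum \<mu> k < psum l k" if "i \<le> k" "k < j" for k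
        using that i le[of k] by (metis order_le_less)
      \<comment> \<open>At the predecessor \<open>p\<close> of \<open>j\<close> the partial sum of
        \<open>\<mu>\<close> is still smaller, and at \<open>j\<close> the two agree; so
        \<open>\<mu>\<close> has the larger entry at \<open>j\<close>.\<close>
      obtain p where "i \<le> p" "p < j" "\<And>\<alpha>. (\<Sum>k<j. lookup \<alpha> k) = psum \<alpha> p"
        using sum_less_eq_psum[of i j] j by blast
      then have "lookup l j < lookup \<mu> j"
        using less[of p] j by (simp add: psum_eq_sum_less[of _ j])
      moreover have "lookup l i \<le> lookup l j"
        using partitionsD[OF l less_imp_le] j by blast
      ultimately have *: "lookup \<mu> i < lookup \<mu> j" "lookup \<mu> j \<noteq> 0"
        using \<open>lookup \<mu> i < lookup l i\<close> by simp_all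
      from dominated_shift[OF step(1) _ _ less] show ?thesis
        using * j step.prems by (intro step.IH[of "shift \<mu> i j"] sym_shiftedD(3)[OF A]) auto
    next
      case False
      then have "psum \<mu> k < psum l k" if "i \<le> k" for k
        using that i le[of k] by (metis order_le_less)
      then show ?thesis
        using dominated_add_single[OF step(1), of i] step.prems up_closedD[OF sym_shiftedD(1)[OF A]]
        by (intro step.IH[of "_ + Poly_Mapping.single i 1"]) blast+
    qed
  qed
qed

text \<open>Passing from the first positions to their image under \<open>\<sigma>\<close> exchanges
  positions up to \<open>k\<close> for equally many beyond \<open>k\<close>. The entry at
  \<open>k\<close> separates the two kinds of values.\<close>

lemma partition_dominated_permute:
  assumes \<mu>: "\<mu> \<in> partitions" and \<sigma>: "bij \<sigma>"
  shows "dominated \<mu> (permute \<sigma> \<mu>)"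
  unfolding dominated_def
proof
  fix k
  let ?D = "{..k}" and ?E = "\<sigma> ` {..k}"
  have inj: "inj_on \<sigma> S" for S
    using \<sigma> by (metis bij_is_inj inj_on_subset subset_UNIV)
  have "card ?E = card ?D"
    by (rule card_image[OF inj])
  then have card: "card (?D - ?E) = card (?E - ?D)"
    by (simp add: card_Diff_subset_Int Int_commute)
  have "(\<Sum>i\<in>?D - ?E. lookup \<mu> i) \<le> of_nat (card (?D - ?E)) * lookup \<mu> k"
    by (intro sum_bounded_above) (use partitionsD[OF \<mu>] in auto)
  also have "\<dots> \<le> (\<Sum>i\<in>?E - ?D. lookup \<mu> i)"
    unfolding card by (intro sum_bounded_below) (use partitionsD[OF \<mu>] in auto)
  finally have "(\<Sum>i\<in>?D. lookup \<mu> i) \<le> (\<Sum>i\<in>?E. lookup \<mu> i)"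
    using sum.Int_Diff[of ?D "lookup \<mu>" ?E] sum.Int_Diff[of ?E "lookup \<mu>" ?D]
    by (simp add: Int_commute)
  also have "\<dots> = psum (permute \<sigma> \<mu>) k"
    using \<sigma> by (simp add: psum_def sum.reindex[OF inj])
  finally show "psum \<mu> k \<le> psum (permute \<sigma> \<mu>) k"
    by (simp add: psum_def)
qed

section \<open>Borel closures, symmetric closures and partition Borel generators\<close>

definition dominating :: "('n::{finite, linorder} \<Rightarrow>\<^sub>0 nat) set \<Rightarrow> ('n \<Rightarrow>\<^sub>0 nat) set" where
  "dominating B = {\<beta>. \<exists>\<nu>\<in>B. dominated \<nu> \<beta>}"

lemma subset_dominating: "B \<subseteq> dominating B"
  unfolding dominating_def using dominated_refl by blast

lemma stable_dominating: "stable (dominating B)"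
  unfolding stable_def
proof (intro conjI ballI allI impI)
  show "up_closed (dominating B)"
    unfolding up_closed_def dominating_def
    by (fastforce simp: dominated_def psum_add intro: trans_le_add1)
  fix \<alpha> i j assume "\<alpha> \<in> dominating B" and ij: "i < j \<and> lookup \<alpha> j \<noteq> 0"
  then obtain \<nu> where "\<nu> \<in> B" "dominated \<nu> \<alpha>"
    by (auto simp: dominating_def)
  moreover have "dominated \<alpha> (shift \<alpha> i j)"
    using ij by (simp add: dominated_def psum_shift)
  ultimately show "shift \<alpha> i j \<in> dominating B"
    unfolding dominating_def using dominated_trans by blast
qed

text \<open>The dominance order replaces sequences of Borel moves: \<open>dominating B\<close> is
  stable, and \<open>stable_dominated\<close> puts it inside every stable set containing
  \<open>B\<close>.\<close>

lemma Borel_monomials: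
  "(Borel (monomial ` B) :: ('n::{finite, linorder}, 'k::comm_ring_1) mpoly set) = mono_ideal (dominating B)"
  unfolding Borel_def
proof (rule hull_unique)
  show "monomial ` B \<subseteq> (mono_ideal (dominating B) :: ('n, 'k) mpoly set)"
    using subset_dominating[of B] by auto
  show "strongly_stable (mono_ideal (dominating B) :: ('n, 'k) mpoly set)"
    using stable_dominating[of B] by (simp add: strongly_stable_mono_ideal stableD(1))
  fix S :: "('n, 'k) mpoly set" assume S: "monomial ` B \<subseteq> S" "strongly_stable S"
  then obtain A where A: "stable A" "S = mono_ideal A"
    by (metis strongly_stableE)
  with S(1) have "B \<subseteq> A"
    by auto
  then have "dominating B \<subseteq> A"
    using stable_dominated[OF A(1)] unfolding dominating_def by blast
  then show "mono_ideal (dominating B) \<subseteq> S"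
    by (simp add: A(2) mono_ideal_mono)
qed

lemma subset_core_dominating: "B \<subseteq> partitions \<Longrightarrow> B \<subseteq> symmetric_core (dominating B)"
  using partition_dominated_permute unfolding symmetric_core_def dominating_def by blast

text \<open>It suffices to treat the sorted rearrangement, to which
  \<open>sym_shifted_dominated\<close> applies.\<close>

lemma core_dominating_subset:
  assumes "sym_shifted A" "B \<subseteq> A"
  shows "symmetric_core (dominating B) \<subseteq> A"
proof
  fix \<alpha> assume \<alpha>: "\<alpha> \<in> symmetric_core (dominating B)"
  obtain \<sigma> where \<sigma>: "bij \<sigma>" "permute \<sigma> \<alpha> \<in> partitions"
    by (rule sorting_permutation)
  with \<alpha> obtain \<nu> where "\<nu> \<in> B" "dominated \<nu> (permute \<sigma> \<alpha>)"
    unfolding symmetric_core_def dominating_def by blast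
  with assms \<sigma> have "permute \<sigma> \<alpha> \<in> A"
    using sym_shifted_dominated by blast
  then show "\<alpha> \<in> A"
    using sym_shiftedD(2)[OF assms(1) \<sigma>(1)] by simp
qed

lemma Sss_partitions:
  assumes "B \<subseteq> partitions"
  shows "(Sss B :: ('n::{finite, linorder}, 'k::comm_ring_1) mpoly set) = mono_ideal (symmetric_core (dominating B))"
  unfolding Sss_def
proof (rule hull_unique)
  show "monomial ` B \<subseteq> (mono_ideal (symmetric_core (dominating B)) :: ('n, 'k) mpoly set)"
    using subset_core_dominating[OF assms] by auto
  show "symmetric_strongly_shifted (mono_ideal (symmetric_core (dominating B)) :: ('n, 'k) mpoly set)"
    using sym_shifted_symmetric_core[OF stable_dominating, of B]
    by (simp add: symmetric_strongly_shifted_mono_ideal sym_shiftedD(1))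
  fix S :: "('n, 'k) mpoly set" assume S: "monomial ` B \<subseteq> S" "symmetric_strongly_shifted S"
  then obtain A where A: "sym_shifted A" "S = mono_ideal A"
    by (metis symmetric_strongly_shiftedE)
  with S(1) have "B \<subseteq> A"
    by auto
  then show "mono_ideal (symmetric_core (dominating B)) \<subseteq> S"
    using core_dominating_subset[OF A(1)] by (simp add: A(2) mono_ideal_mono)
qed

lemma mono_ideal_eq_iff:
  "(mono_ideal A :: ('n, 'k::comm_ring_1) mpoly set) = mono_ideal B \<longleftrightarrow> A = B"
proof
  assume eq: "(mono_ideal A :: ('n, 'k) mpoly set) = mono_ideal B"
  have "\<alpha> \<in> A \<longleftrightarrow> \<alpha> \<in> B" for \<alpha>
    using eq monomial_in_mono_ideal[of \<alpha>] by metis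
  then show "A = B" by blast
qed simp

definition dominance_minimal :: "('n::{finite, linorder} \<Rightarrow>\<^sub>0 nat) set \<Rightarrow> ('n \<Rightarrow>\<^sub>0 nat) set" where
  "dominance_minimal P = {\<mu> \<in> P. \<forall>\<nu>\<in>P. dominated \<nu> \<mu> \<longrightarrow> \<nu> = \<mu>}"

text \<open>The sum of all partial sums is strictly monotone for dominance, so its minimum below
  \<open>\<alpha>\<close> is attained at a minimal element.\<close>

lemma dominance_minimal_below:
  assumes "\<alpha> \<in> P"
  shows "\<exists>\<nu>\<in>dominance_minimal P. dominated \<nu> \<alpha>"
proof -
  obtain \<nu> where \<nu>: "\<nu> \<in> P" "dominated \<nu> \<alpha>"
    and min: "\<And>\<mu>. \<mu> \<in> P \<Longrightarrow> dominated \<mu> \<alpha> \<Longrightarrow> (\<Sum>k\<in>UNIV. psum \<nu> k) \<le> (\<Sum>k\<in>UNIV. psum \<mu> k)"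
    using ex_has_least_nat[of "\<lambda>\<nu>. \<nu> \<in> P \<and> dominated \<nu> \<alpha>" \<alpha> "\<lambda>\<nu>. \<Sum>k\<in>UNIV. psum \<nu> k"] assms
    by auto
  have "\<mu> = \<nu>" if \<mu>: "\<mu> \<in> P" "dominated \<mu> \<nu>" for \<mu>
  proof (rule ccontr)
    assume "\<mu> \<noteq> \<nu>"
    then obtain k where "psum \<mu> k \<noteq> psum \<nu> k"
      using psum_inject by blast
    then have "(\<Sum>k\<in>UNIV. psum \<mu> k) < (\<Sum>k\<in>UNIV. psum \<nu> k)"
      using \<mu>(2) unfolding dominated_def
      by (intro sum_strict_mono_ex1) (auto simp: order.strict_iff_order)
    with min[OF \<mu>(1) dominated_trans[OF \<mu>(2) \<nu>(2)]] show False by simp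
  qed
  with \<nu> show ?thesis
    unfolding dominance_minimal_def by blast
qed

text \<open>The \<open>LEAST\<close> is the set \<open>C\<close> of dominance-minimal partitions in
  \<open>A\<close>: if \<open>D\<close> also generates, each \<open>\<mu>\<close> in
  \<open>C\<close> dominates some \<open>\<nu>\<close> in \<open>D\<close>, which is itself a
  partition in \<open>A\<close>, so minimality gives \<open>\<nu> = \<mu>\<close>.\<close>

lemma partition_Borel_generators:
  fixes A :: "('n::{finite, linorder} \<Rightarrow>\<^sub>0 nat) set"
  assumes A: "sym_shifted A"
  defines "B \<equiv> partition_Borel_generators (mono_ideal A :: ('n, 'k::comm_ring_1) mpoly set)"
  shows "B \<subseteq> partitions" and "A = symmetric_core (dominating B)"
proof -
  define C where "C = dominance_minimal (A \<inter> partitions)"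
  have C: "C \<subseteq> partitions" "C \<subseteq> A"
    by (auto simp: C_def dominance_minimal_def)
  have eq: "A = symmetric_core (dominating C)"
  proof
    show "symmetric_core (dominating C) \<subseteq> A"
      using core_dominating_subset[OF A C(2)] .
    show "A \<subseteq> symmetric_core (dominating C)"
    proof
      fix \<alpha> assume \<alpha>: "\<alpha> \<in> A"
      obtain \<sigma> where \<sigma>: "bij \<sigma>" "permute \<sigma> \<alpha> \<in> partitions"
        by (rule sorting_permutation)
      then have "permute \<sigma> \<alpha> \<in> A \<inter> partitions"
        using \<alpha> sym_shiftedD(2)[OF A] by simp
      from dominance_minimal_below[OF this] obtain \<nu> where \<nu>: "\<nu> \<in> C" "dominated \<nu> (permute \<sigma> \<alpha>)"
        unfolding C_def by blast
      \<comment> \<open>Every rearrangement of \<open>\<alpha>\<close> is one of its sorted form,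
        and therefore dominates it.\<close>
      have "permute \<tau> \<alpha> \<in> dominating C" if \<tau>: "bij \<tau>" for \<tau>
      proof -
        have inv: "bij (inv \<sigma>)"
          using \<sigma>(1) by (rule bij_imp_bij_inv)
        have "permute \<tau> \<alpha> = permute \<tau> (permute (inv \<sigma>) (permute \<sigma> \<alpha>))"
          using \<sigma>(1) by simp
        also have "\<dots> = permute (inv \<sigma> \<circ> \<tau>) (permute \<sigma> \<alpha>)"
          using inv \<tau> by (rule permute_comp)
        finally have "dominated (permute \<sigma> \<alpha>) (permute \<tau> \<alpha>)"
          using partition_dominated_permute[OF \<sigma>(2) bij_comp[OF \<tau> inv]] by simp
        with \<nu> show ?thesis
          unfolding dominating_def using dominated_trans by blast
      qed
      then show "\<alpha> \<in> symmetric_core (dominating C)"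
        by (simp add: symmetric_core_def)
    qed
  qed
  have "B = C"
    unfolding B_def partition_Borel_generators_def
  proof (rule Least_equality)
    show "C \<subseteq> partitions \<and> mono_ideal A = (Sss C :: ('n, 'k) mpoly set)"
      using C(1) eq by (simp add: Sss_partitions)
    fix D assume *: "D \<subseteq> partitions \<and> mono_ideal A = (Sss D :: ('n, 'k) mpoly set)"
    then have D: "D \<subseteq> partitions" ..
    from * have D_eq: "A = symmetric_core (dominating D)"
      by (simp add: Sss_partitions[OF D] mono_ideal_eq_iff)
    show "C \<subseteq> D"
    proof
      fix \<mu> assume \<mu>: "\<mu> \<in> C"
      then have "\<mu> \<in> dominating D"
        using C(2) D_eq symmetric_core_subset by blast
      then obtain \<nu> where \<nu>: "\<nu> \<in> D" "dominated \<nu> \<mu>"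
        by (auto simp: dominating_def)
      moreover have "\<nu> \<in> A \<inter> partitions"
        using D \<nu>(1) subset_core_dominating[of D] D_eq by blast
      ultimately have "\<nu> = \<mu>"
        using \<mu> by (simp add: C_def dominance_minimal_def)
      with \<nu>(1) show "\<mu> \<in> D" by simp
    qed
  qed
  with C(1) eq show "B \<subseteq> partitions" "A = symmetric_core (dominating B)"
    by simp_all
qed

text \<open>The summands of a partition in the power of \<open>dominating B\<close> need not lie in
  the core. They are replaced by generators below them, and the shifting property of the power of
  the core leads back up.\<close>

lemma exponent_power_symmetric_core:
  assumes B: "B \<subseteq> partitions"
  shows "exponent_power (symmetric_core (dominating B)) m = symmetric_core (exponent_power (dominating B) m)"
    (is "exponent_power ?A m = _")
proof
  have A: "sym_shifted (exponent_power ?A k)" for k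
    by (intro sym_shifted_exponent_power sym_shifted_symmetric_core stable_dominating)
  show "exponent_power ?A m \<subseteq> symmetric_core (exponent_power (dominating B) m)"
    using exponent_power_mono[OF symmetric_core_subset, of "dominating B" m] sym_shiftedD(2)[OF A]
    unfolding symmetric_core_def by blast
  \<comment> \<open>No sortedness of \<open>\<gamma>\<close> is demanded, so the induction can split
    it freely; sorting enters only once, for the whole sum.\<close>
  have below: "\<exists>\<nu>\<in>exponent_power ?A k. dominated \<nu> \<gamma>" if "\<gamma> \<in> exponent_power (dominating B) k" for \<gamma> k
    using that
  proof (induction k arbitrary: \<gamma>)
    case 0
    show ?case by (auto intro: dominated_refl)
  next
    case (Suc k)
    then obtain \<alpha> \<beta> where \<gamma>: "\<gamma> = \<alpha> + \<beta>" "\<alpha> \<in> dominating B" "\<beta> \<in> exponent_power (dominating B) k"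
      by (elim exponent_power_SucE)
    then obtain \<nu> \<nu>' where "\<nu> \<in> B" "dominated \<nu> \<alpha>" "\<nu>' \<in> exponent_power ?A k" "dominated \<nu>' \<beta>"
      using Suc.IH unfolding dominating_def by blast
    then show ?case
      using exponent_power_Suc subset_core_dominating[OF B] dominated_add \<gamma>(1) by blast
  qed
  show "symmetric_core (exponent_power (dominating B) m) \<subseteq> exponent_power ?A m"
  proof
    fix \<alpha> assume \<alpha>: "\<alpha> \<in> symmetric_core (exponent_power (dominating B) m)"
    obtain \<sigma> where \<sigma>: "bij \<sigma>" "permute \<sigma> \<alpha> \<in> partitions"
      by (rule sorting_permutation)
    with \<alpha> have "permute \<sigma> \<alpha> \<in> exponent_power (dominating B) m"
      by (simp add: symmetric_core_def)
    with below obtain \<nu> where "\<nu> \<in> exponent_power ?A m" "dominated \<nu> (permute \<sigma> \<alpha>)"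
      by blast
    then have "permute \<sigma> \<alpha> \<in> exponent_power ?A m"
      using sym_shifted_dominated[OF A \<sigma>(2)] by blast
    then show "\<alpha> \<in> exponent_power ?A m"
      using sym_shiftedD(2)[OF A \<sigma>(1)] by blast
  qed
qed

lemma normal_symmetric_strongly_shifted:
  fixes I :: "('n::{finite, linorder}, 'k::comm_ring_1) mpoly set"
  assumes I: "symmetric_strongly_shifted I"
    and J: "normal_ideal (Borel (monomial ` partition_Borel_generators I) :: ('n, 'k) mpoly set)"
  shows "normal_ideal I"
proof -
  obtain A where A: "sym_shifted A" "I = mono_ideal A"
    using I by (rule symmetric_strongly_shiftedE)
  define B where "B = partition_Borel_generators I"
  have B: "B \<subseteq> partitions" "I = mono_ideal (symmetric_core (dominating B))"
    using partition_Borel_generators[OF A(1), where 'k = 'k] by (simp_all add: A(2) B_def)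
  have "ideal_power I m = symmetrization (ideal_power (Borel (monomial ` B)) m)" for m
    by (simp add: B ideal_power_mono_ideal exponent_power_symmetric_core Borel_monomials symmetrization_mono_ideal)
  then show ?thesis
    using J by (simp add: normal_ideal_def B_def integrally_closed_symmetrization)
qed

text \<open>The bounds are the partial sums of \<open>m\<close> times \<open>\<mu>\<close>, a vector
  that lies in the power itself; satisfying them all means dominating it.\<close>

lemma normal_principal_Borel:
  "normal_ideal (Borel {monomial \<mu>} :: ('n::{finite, linorder}, 'k::idom) mpoly set)"
proof -
  let ?A = "dominating {\<mu>}"
  let ?W = "range (\<lambda>k. (\<lambda>\<alpha>. psum \<alpha> k, psum \<mu> k))"
  have "normal_ideal (mono_ideal ?A :: ('n, 'k) mpoly set)"
  proof (rule normal_mono_ideal[where W = ?W])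
    fix w c assume "(w, c) \<in> ?W"
    then obtain k where "w = (\<lambda>\<alpha>. psum \<alpha> k)" "c = psum \<mu> k"
      by auto
    then show "weight w \<and> ?A \<subseteq> weight_ge w c"
      by (auto simp: weight_def psum_add weight_ge_def dominating_def dominated_def)
  next
    fix m
    have "\<exists>\<nu>\<in>exponent_power ?A m. \<forall>k. psum \<nu> k = m * psum \<mu> k"
    proof (induction m)
      case 0
      show ?case by (auto simp: psum_def intro!: exI[of _ 0])
    next
      case (Suc m)
      then obtain \<nu> where "\<nu> \<in> exponent_power ?A m" "\<forall>k. psum \<nu> k = m * psum \<mu> k"
        by blast
      then show ?case
        using subset_dominating[of "{\<mu>}"] exponent_power_Suc[of \<mu> ?A \<nu> m]
        by (intro bexI[of _ "\<mu> + \<nu>"]) (auto simp: psum_add)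
    qed
    then obtain \<nu> where \<nu>: "\<nu> \<in> exponent_power ?A m" "\<And>k. psum \<nu> k = m * psum \<mu> k"
      by blast
    show "(\<Inter>(w, c)\<in>?W. weight_ge w (m * c)) \<subseteq> exponent_power ?A m"
    proof
      fix \<beta> assume "\<beta> \<in> (\<Inter>(w, c)\<in>?W. weight_ge w (m * c))"
      then have "dominated \<nu> \<beta>"
        by (auto simp: weight_ge_def dominated_def \<nu>(2))
      then show "\<beta> \<in> exponent_power ?A m"
        using stable_dominated[OF stable_exponent_power[OF stable_dominating]] \<nu>(1) by blast
    qed
  qed
  then show ?thesis
    using Borel_monomials[of "{\<mu>}", where 'k = 'k] by simp
qed

section \<open>Lex-segment ideals\<close>

text \<open>Unrolled, this sums \<open>b i\<close> times the product of \<open>a j + 1\<close> over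
  \<open>i < j < k\<close>: the \<open>b i\<close> are read as digits in the mixed radix with bases
  \<open>a j + 1\<close>. There \<open>a\<close> has maximal digits, so
  \<open>carry a a k + 1\<close> is the product of all \<open>a j + 1\<close> with
  \<open>j < k\<close>.\<close>

primrec carry :: "(nat \<Rightarrow> nat) \<Rightarrow> (nat \<Rightarrow> nat) \<Rightarrow> nat \<Rightarrow> nat" where
  "carry a b 0 = 0"
| "carry a b (Suc k) = carry a b k * Suc (a k) + b k"

lemma carry_add:
  assumes "\<And>i. i < k \<Longrightarrow> b i = c i + d i"
  shows "carry a b k = carry a c k + carry a d k"
  using assms by (induction k) (simp_all add: algebra_simps)

text \<open>Let \<open>b\<close> be a sum of \<open>m\<close> sequences that are lexicographically at least \<open>a\<close>, and let \<open>r k\<close> of them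
  agree with \<open>a\<close> in the first \<open>k\<close> positions. Then \<open>r k * a k \<le> b k\<close>, and at most
  \<open>b k - r k * a k\<close> of these \<open>r k\<close> summands exceed \<open>a\<close> at \<open>k\<close>. Replacing \<open>r\<close> by the solution \<open>m * (carry a a k + 1) - carry a b k\<close> of the recursion
  \<open>r (k + 1) = r k - (b k - r k * a k)\<close> with \<open>r 0 = m\<close>, the first inequality becomes
  \<open>m * lex_weight a k a \<le> lex_weight a k b\<close>.\<close>

definition lex_weight :: "(nat \<Rightarrow> nat) \<Rightarrow> nat \<Rightarrow> (nat \<Rightarrow> nat) \<Rightarrow> nat" where
  "lex_weight a k b = b k + a k * carry a b k"

text \<open>As \<open>a\<close> has maximal digits, \<open>g\<close> is ahead by at least one unit
  of \<open>carry\<close> at every place after \<open>k\<close>, whatever its later entries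
  are.\<close>

lemma lex_weight_mono_lex:
  assumes "a k < g k" "\<And>i. i < k \<Longrightarrow> g i = a i"
  shows "lex_weight a l a \<le> lex_weight a l g"
proof -
  have eq: "carry a g j = carry a a j" if "j \<le> k" for j
    using that assms(2) by (induction j) auto
  have gt: "Suc (carry a a j) \<le> carry a g j" if "Suc k \<le> j" for j
    using that
  proof (induction rule: dec_induct)
    case base
    show ?case using eq[of k] assms(1) by simp
  next
    case (step j)
    have "Suc (carry a a j) * Suc (a j) \<le> carry a g j * Suc (a j)"
      using step.IH by (rule mult_le_mono1)
    then show ?case by (simp add: algebra_simps)
  qed
  show ?thesis
  proof (cases "l \<le> k")
    case True
    then show ?thesis
      using eq[of l] assms by (cases "l = k") (auto simp: lex_weight_def)
  next
    case False
    \<comment> \<open>\<open>lex_weight a l a\<close> equals \<open>a l * Suc (carry a a l)\<close>,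
      so one unit of \<open>carry\<close> makes up even for \<open>g l = 0\<close>.\<close>
    then have "a l * Suc (carry a a l) \<le> a l * carry a g l"
      by (intro mult_le_mono2 gt) simp
    then show ?thesis by (simp add: lex_weight_def)
  qed
qed

text \<open>Greedy filling; it distributes the part of a split-off summand behind its first
  deviation from \<open>a\<close>.\<close>

lemma bounded_summands:
  fixes b :: "'a \<Rightarrow> nat"
  assumes "finite S" "t \<le> sum b S"
  shows "\<exists>h. (\<forall>i\<in>S. h i \<le> b i) \<and> sum h S = t"
  using assms
proof (induction S arbitrary: t rule: finite_induct)
  case (insert x S)
  have "t - min t (b x) \<le> sum b S"
    using insert by simp
  then obtain h where h: "\<forall>i\<in>S. h i \<le> b i" "sum h S = t - min t (b x)"
    using insert.IH by blast
  have "sum (h(x := min t (b x))) S = sum h S"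
    using insert.hyps by (intro sum.cong) auto
  then show ?case
    using h insert.hyps by (intro exI[of _ "h(x := min t (b x))"]) auto
qed simp

lemma sum_lessThan_split:
  fixes f :: "nat \<Rightarrow> 'a::comm_monoid_add"
  assumes "k < N"
  shows "sum f {..<N} = sum f {..<k} + (f k + sum f {Suc k..<N})"
proof -
  have "{..<N} = {..<k} \<union> insert k {Suc k..<N}"
    using assms by auto
  then have "sum f {..<N} = sum f ({..<k} \<union> insert k {Suc k..<N})"
    by (rule arg_cong)
  also have "\<dots> = sum f {..<k} + (f k + sum f {Suc k..<N})"
    by (subst sum.union_disjoint) auto
  finally show ?thesis .
qed

text \<open>In the proof, \<open>M k\<close> is the lower bound for the number of summands of \<open>b\<close> that agree with \<open>a\<close> in
  the first \<open>k\<close> positions, so the weight condition reads \<open>M k * a k \<le> b k\<close>. If \<open>M\<close> stays positive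
  then \<open>a \<le> b\<close> and \<open>a\<close> is split off. Otherwise the summand split off exceeds \<open>a\<close> at the last
  position before \<open>M\<close> becomes nonpositive, and takes as much as possible from the positions behind.\<close>

lemma lex_split:
  fixes a b :: "nat \<Rightarrow> nat"
  assumes weight: "\<And>k. k < N \<Longrightarrow> Suc m * lex_weight a k a \<le> lex_weight a k b"
    and deg: "Suc m * sum a {..<N} \<le> sum b {..<N}"
  obtains g where "\<And>i. i < N \<Longrightarrow> g i \<le> b i" "sum g {..<N} = sum a {..<N}"
    "(\<forall>i<N. g i = a i) \<or> (\<exists>k<N. a k < g k \<and> (\<forall>i<k. g i = a i))"
    "\<And>k. k < N \<Longrightarrow> m * lex_weight a k a \<le> lex_weight a k (\<lambda>i. b i - g i)"
proof -
  \<comment> \<open>Integer-valued, since it may become nonpositive; the factor is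
    \<open>Suc m\<close> because one summand is still to be removed.\<close>
  define M where "M k = int (Suc m) * int (Suc (carry a a k)) - int (carry a b k)" for k
  have M_0: "M 0 = int m + 1"
    by (simp add: M_def)
  have M_Suc: "M (Suc k) = M k * (int (a k) + 1) - int (b k)" for k
    unfolding M_def carry.simps of_nat_mult of_nat_add of_nat_Suc by algebra
  have int_weight: "int (lex_weight a k c) = int (c k) + int (a k) * int (carry a c k)" for k c
    by (simp add: lex_weight_def)
  have M_le: "M k * int (a k) \<le> int (b k)" if "k < N" for k
  proof -
    have "int (Suc m * lex_weight a k a) \<le> int (lex_weight a k b)"
      using weight[OF that] by (simp only: of_nat_le_iff)
    moreover have "int (Suc m * lex_weight a k a) - int (lex_weight a k b) = M k * int (a k) - int (b k)"
      unfolding M_def of_nat_mult int_weight of_nat_Suc by algebra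
    ultimately show ?thesis by linarith
  qed
  have rest: "m * lex_weight a k a \<le> lex_weight a k (\<lambda>i. b i - g i)"
    if "(int m * int (Suc (carry a a k)) - int (carry a (\<lambda>i. b i - g i) k)) * int (a k) \<le> int (b k - g k)" for g k
  proof -
    have "int (m * lex_weight a k a) - int (lex_weight a k (\<lambda>i. b i - g i)) =
        (int m * int (Suc (carry a a k)) - int (carry a (\<lambda>i. b i - g i) k)) * int (a k) - int (b k - g k)"
      unfolding of_nat_mult int_weight of_nat_Suc by algebra
    with that have "int (m * lex_weight a k a) \<le> int (lex_weight a k (\<lambda>i. b i - g i))"
      by linarith
    then show ?thesis by (simp only: of_nat_le_iff)
  qed
  \<comment> \<open>Removing a summand that agrees with \<open>a\<close> before position
    \<open>k\<close> lowers the count there by exactly one.\<close>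
  have agree: "int m * int (Suc (carry a a k)) - int (carry a (\<lambda>i. b i - g i) k) = M k - 1"
    if "\<And>i. i < k \<Longrightarrow> g i = a i \<and> a i \<le> b i" for g k
  proof -
    have "carry a b k = carry a (\<lambda>i. b i - g i) k + carry a a k"
      by (rule carry_add) (use that in force)
    then show ?thesis by (simp add: M_def algebra_simps)
  qed
  have agree_le: "(int m * int (Suc (carry a a k)) - int (carry a (\<lambda>i. b i - g i) k)) * int (a k) \<le> int (b k - g k)"
    if "k < N" "\<And>i. i \<le> k \<Longrightarrow> g i = a i \<and> a i \<le> b i" for g k
    using that M_le[OF that(1)] by (subst agree) (auto simp: algebra_simps of_nat_diff)
  show ?thesis
  proof (cases "\<forall>k<N. a k \<le> b k")
    case True
    show ?thesis
    proof (rule that[of a])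
      show "m * lex_weight a k a \<le> lex_weight a k (\<lambda>i. b i - a i)" if "k < N" for k
        using True that by (intro rest agree_le) auto
    qed (use True in auto)
  next
    case False
    then obtain q where q: "q < N" "b q < a q"
      by (auto simp: not_le)
    have pos_le: "a i \<le> b i" if "i < N" "0 < M i" for i
    proof -
      have "int (a i) \<le> M i * int (a i)"
        using that(2) by (simp add: mult_le_cancel_right1)
      with M_le[OF that(1)] show ?thesis by simp
    qed
    from q pos_le have "M q \<le> 0"
      by (meson not_le)
    then obtain k' where k': "M k' \<le> 0" and "\<And>i. i < k' \<Longrightarrow> \<not> M i \<le> 0"
      using exists_least_iff[of "\<lambda>k. M k \<le> 0"] by blast
    then have k'_min: "\<And>i. i < k' \<Longrightarrow> 0 < M i"
      by (simp add: not_le)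
    with \<open>M q \<le> 0\<close> have "k' \<le> q"
      by (meson not_le)
    have "k' \<noteq> 0"
      using k' M_0 by (intro notI) simp
    then obtain k where k: "k' = Suc k"
      using not0_implies_Suc by blast
    have kN: "k < q" "k < N" and pos: "\<And>i. i \<le> k \<Longrightarrow> 0 < M i"
      using \<open>k' \<le> q\<close> k'_min q(1) by (auto simp: k)
    \<comment> \<open>\<open>M (Suc k) \<le> 0\<close> says that \<open>b k\<close> is large enough
      for \<open>M k\<close> summands to exceed \<open>a\<close> at \<open>k\<close>.\<close>
    have bk: "M k * (int (a k) + 1) \<le> int (b k)"
      using k' M_Suc[of k] unfolding k by linarith
    \<comment> \<open>Since \<open>b j = M j * a j + (M j - M (Suc j))\<close>, the excess of
      \<open>b\<close> over \<open>m + 1\<close> copies of \<open>a\<close> telescopes.\<close>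
    have M_bound: "M j \<le> int m + 1 \<and> int (sum b {..<j}) \<le> (int m + 1) * int (sum a {..<j}) + (int m + 1 - M j)"
      if "j \<le> k" for j
      using that
    proof (induction j)
      case 0
      show ?case by (simp add: M_0)
    next
      case (Suc j)
      then have IH: "M j \<le> int m + 1" "int (sum b {..<j}) \<le> (int m + 1) * int (sum a {..<j}) + (int m + 1 - M j)"
        by auto
      have "M j * int (a j) \<le> (int m + 1) * int (a j)"
        using IH(1) by (intro mult_right_mono) auto
      moreover have "M j * int (a j) \<le> int (b j)"
        using Suc.prems kN by (intro M_le) simp
      moreover have "M (Suc j) = M j * int (a j) + M j - int (b j)"
        unfolding M_Suc by algebra
      moreover have "(int m + 1) * int (sum a {..<Suc j}) = (int m + 1) * int (sum a {..<j}) + (int m + 1) * int (a j)"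
        unfolding sum.lessThan_Suc of_nat_add by algebra
      moreover have "int (sum b {..<Suc j}) = int (sum b {..<j}) + int (b j)"
        by simp
      ultimately show ?case
        using IH by linarith
    qed
    let ?A = "sum a {..<k}" and ?T = "sum b {Suc k..<N}"
    have "sum a {..<N} = ?A + (a k + sum a {Suc k..<N})"
      by (rule sum_lessThan_split[OF kN(2)])
    \<comment> \<open>The entry \<open>a q\<close> is positive and lies behind \<open>k\<close>, so
      exceeding \<open>a\<close> by one at \<open>k\<close> stays within the degree of
      \<open>a\<close>.\<close>
    moreover have "a q \<le> sum a {Suc k..<N}"
      using kN(1) q(1) by (intro member_le_sum) auto
    ultimately have d: "?A + Suc (a k) \<le> sum a {..<N}"
      using q(2) by simp
    define r where "r = sum a {..<N} - ?A"
    \<comment> \<open>Of the remaining degree \<open>r\<close>, the positions behind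
      \<open>k\<close> supply \<open>t\<close>, bounded by what \<open>b\<close> has there and by
      the need to leave at least \<open>a k + 1\<close> at \<open>k\<close>.\<close>
    define t where "t = min ?T (r - Suc (a k))"
    obtain h where h: "\<forall>i\<in>{Suc k..<N}. h i \<le> b i" "sum h {Suc k..<N} = t"
      using bounded_summands[of "{Suc k..<N}" t b] by (auto simp: t_def)
    have r: "Suc (a k) \<le> r - t" "t \<le> r" "int r = int (sum a {..<N}) - int ?A"
      using d by (auto simp: r_def t_def)
    \<comment> \<open>The other \<open>M k - 1\<close> tied summands must still be able to exceed
      \<open>a\<close> at \<open>k\<close>. If \<open>t\<close> leaves exactly
      \<open>a k + 1\<close>, this is \<open>bk\<close>; otherwise the tail of \<open>b\<close> is
      used up and the degree condition forces \<open>b k\<close> to be large.\<close>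
    have gk: "(M k - 1) * (int (a k) + 1) \<le> int (b k) - int (r - t)"
    proof (cases "t = r - Suc (a k)")
      case True
      then have "int (r - t) = int (a k) + 1"
        using r(1) by simp
      then show ?thesis
        using bk by (simp add: algebra_simps)
    next
      case False
      then have t: "t = ?T"
        by (auto simp: t_def min_def split: if_splits)
      have "int (sum b {..<N}) = int (sum b {..<k}) + int (b k) + int t"
        using sum_lessThan_split[OF kN(2), of b] by (simp add: t)
      moreover have "(int m + 1) * int (sum a {..<N}) \<le> int (sum b {..<N})"
        using deg by (metis of_nat_Suc of_nat_le_iff of_nat_mult add.commute)
      moreover have "int m * (int (a k) + 1) \<le> int m * int r"
        using r(1) by (intro mult_left_mono) auto
      moreover have "0 \<le> (int m + 1 - M k) * int (a k)"
        using M_bound[of k] by simp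
      moreover have "int (sum b {..<k}) \<le> (int m + 1) * int ?A + (int m + 1 - M k)"
        using M_bound[of k] by simp
      ultimately show ?thesis
        using r(2,3) by (simp add: algebra_simps of_nat_diff)
    qed
    define g where "g i = (if i < k then a i else if i = k then r - t else h i)" for i
    have "0 \<le> (M k - 1) * (int (a k) + 1)"
      using pos[of k] by simp
    with gk have gk_le: "r - t \<le> b k"
      by linarith
    have g_low: "g i = a i \<and> a i \<le> b i" if "i < k" for i
      using that pos_le[of i] pos[of i] kN by (simp add: g_def)
    show ?thesis
    proof (rule that[of g])
      show "g i \<le> b i" if "i < N" for i
      proof (cases i k rule: linorder_cases)
        case less
        then show ?thesis using g_low by simp
      next
        case equal
        then show ?thesis using gk_le by (simp add: g_def)
      next
        case greater
        then show ?thesis using h(1) that by (simp add: g_def)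
      qed
      have "sum g {..<k} = ?A" "sum g {Suc k..<N} = t"
        unfolding h(2)[symmetric] by (intro sum.cong; simp add: g_def)+
      then show "sum g {..<N} = sum a {..<N}"
        using r(2) d sum_lessThan_split[OF kN(2), of g] by (simp add: g_def r_def)
      show "(\<forall>i<N. g i = a i) \<or> (\<exists>k<N. a k < g k \<and> (\<forall>i<k. g i = a i))"
        using r(1) kN(2) by (intro disjI2 exI[of _ k]) (simp add: g_def)
      define M' where "M' j = int m * int (Suc (carry a a j)) - int (carry a (\<lambda>i. b i - g i) j)" for j
      have M'_Suc: "M' (Suc j) = M' j * (int (a j) + 1) - int (b j - g j)" for j
        unfolding M'_def carry.simps of_nat_mult of_nat_add of_nat_Suc by algebra
      have M'_k: "M' k = M k - 1"
        unfolding M'_def using g_low by (intro agree)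
      have gk': "(M k - 1) * (int (a k) + 1) \<le> int (b k - g k)"
        using gk gk_le by (simp add: g_def of_nat_diff)
      \<comment> \<open>Behind \<open>k\<close> the count for the remainder is nonpositive, which
        makes its weight inequalities trivial.\<close>
      have high: "M' j \<le> 0" if "Suc k \<le> j" for j
        using that
      proof (induction rule: dec_induct)
        case base
        show ?case using gk' by (simp add: M'_Suc M'_k)
      next
        case (step j)
        then have "M' j * (int (a j) + 1) \<le> 0"
          by (simp add: mult_le_0_iff)
        then show ?case by (simp add: M'_Suc)
      qed
      show "m * lex_weight a j a \<le> lex_weight a j (\<lambda>i. b i - g i)" if "j < N" for j
      proof (cases j k rule: linorder_cases)
        case less
        then show ?thesis using that g_low by (intro rest agree_le) auto
      next
        case equal
        have "(M k - 1) * int (a k) \<le> (M k - 1) * (int (a k) + 1)"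
          using pos[of k] by (intro mult_left_mono) auto
        then have "M' k * int (a k) \<le> int (b k - g k)"
          using gk' unfolding M'_k by linarith
        then show ?thesis
          unfolding M'_def equal by (rule rest)
      next
        case greater
        then have "M' j * int (a j) \<le> 0"
          using high[of j] by (simp add: mult_le_0_iff)
        then show ?thesis
          unfolding M'_def by (intro rest) linarith
      qed
    qed
  qed
qed

section \<open>From sequences to exponent vectors\<close>

lemma increasing_enumeration:
  obtains e :: "nat \<Rightarrow> 'n::{finite, linorder}"
  where "bij_betw e {..<CARD('n)} UNIV" "\<And>i j. i < j \<Longrightarrow> j < CARD('n) \<Longrightarrow> e i < e j"
proof (rule that)
  let ?xs = "sorted_list_of_set (UNIV :: 'n set)"
  show "bij_betw ((!) ?xs) {..<CARD('n)} UNIV"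
    by (rule bij_betw_nth) auto
  show "?xs ! i < ?xs ! j" if "i < j" "j < CARD('n)" for i j
    using that by (simp add: sorted_wrt_nth_less strict_sorted_iff)
qed

lemma lex_le_enum:
  fixes \<alpha> \<beta> :: "'n::{finite, linorder} \<Rightarrow>\<^sub>0 nat"
  assumes e: "bij_betw e {..<CARD('n)} UNIV" "\<And>i j. i < j \<Longrightarrow> j < CARD('n) \<Longrightarrow> e i < e j"
  shows "\<alpha> \<le> \<beta> \<longleftrightarrow> (\<forall>i<CARD('n). lookup \<beta> (e i) = lookup \<alpha> (e i)) \<or>
    (\<exists>k<CARD('n). lookup \<alpha> (e k) < lookup \<beta> (e k) \<and> (\<forall>i<k. lookup \<beta> (e i) = lookup \<alpha> (e i)))"
proof -
  have surj: "\<exists>k<CARD('n). j = e k" for j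
    using e(1) by (auto simp: bij_betw_def)
  have less: "e i < e k \<longleftrightarrow> i < k" if "i < CARD('n)" "k < CARD('n)" for i k
    using e(2)[of i k] e(2)[of k i] that by (cases i k rule: linorder_cases) auto
  have "\<alpha> = \<beta> \<longleftrightarrow> (\<forall>i<CARD('n). lookup \<beta> (e i) = lookup \<alpha> (e i))"
    using surj by (metis poly_mapping_eqI)
  moreover have "\<alpha> < \<beta> \<longleftrightarrow>
    (\<exists>k<CARD('n). lookup \<alpha> (e k) < lookup \<beta> (e k) \<and> (\<forall>i<k. lookup \<beta> (e i) = lookup \<alpha> (e i)))"
    unfolding exponent_less_iff
  proof safe
    fix j assume *: "lookup \<alpha> j < lookup \<beta> j" "\<forall>l<j. lookup \<alpha> l = lookup \<beta> l"
    obtain k where "k < CARD('n)" "j = e k"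
      using surj by blast
    with * show "\<exists>k<CARD('n). lookup \<alpha> (e k) < lookup \<beta> (e k) \<and> (\<forall>i<k. lookup \<beta> (e i) = lookup \<alpha> (e i))"
      using e(2) by (intro exI[of _ k]) auto
  next
    fix k assume *: "k < CARD('n)" "lookup \<alpha> (e k) < lookup \<beta> (e k)" "\<forall>i<k. lookup \<beta> (e i) = lookup \<alpha> (e i)"
    have "lookup \<alpha> l = lookup \<beta> l" if "l < e k" for l
      using surj[of l] less * that by force
    with * show "\<exists>j. lookup \<alpha> j < lookup \<beta> j \<and> (\<forall>l<j. lookup \<alpha> l = lookup \<beta> l)"
      by blast
  qed
  ultimately show ?thesis
    by (metis order_le_less)
qed

lemma total_degree_add: "total_degree (\<alpha> + \<beta>) = total_degree \<alpha> + total_degree \<beta>"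
  by (simp add: total_degree_def lookup_add sum.distrib)

text \<open>\<open>\<alpha>\<close> plays the role of the last generator. \<open>lex_split\<close>
  removes one generator so that the rest satisfies the inequalities for \<open>m\<close> instead of
  \<open>m + 1\<close>, and induction completes the decomposition.\<close>

lemma normal_lex_segment:
  fixes A :: "('n::{finite, linorder} \<Rightarrow>\<^sub>0 nat) set"
  assumes generated: "\<And>\<beta>. \<beta> \<in> A \<Longrightarrow> \<exists>\<gamma> \<delta>. \<beta> = \<gamma> + \<delta> \<and> total_degree \<gamma> = total_degree \<alpha> \<and> \<alpha> \<le> \<gamma>"
    and segment: "\<And>\<gamma>. total_degree \<gamma> = total_degree \<alpha> \<Longrightarrow> \<alpha> \<le> \<gamma> \<Longrightarrow> \<gamma> \<in> A"
  shows "normal_ideal (mono_ideal A :: ('n, 'k::idom) mpoly set)"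
proof -
  obtain e :: "nat \<Rightarrow> 'n" where e: "bij_betw e {..<CARD('n)} UNIV" "\<And>i j. i < j \<Longrightarrow> j < CARD('n) \<Longrightarrow> e i < e j"
    using increasing_enumeration by blast
  let ?N = "CARD('n)"
  define seq where "seq \<beta> i = lookup \<beta> (e i)" for \<beta> :: "'n \<Rightarrow>\<^sub>0 nat" and i
  define w where "w k \<beta> = lex_weight (seq \<alpha>) k (seq \<beta>)" for k \<beta>
  \<comment> \<open>The lexicographic weights do not control the degree: for
    \<open>\<alpha> = (0,2,0)\<close> and \<open>m = 1\<close> the vector \<open>(1,0,0)\<close>
    satisfies all of them.\<close>
  define W where "W = insert (total_degree, total_degree \<alpha>) ((\<lambda>k. (w k, w k \<alpha>)) ` {..<?N})"
  have deg: "total_degree \<beta> = sum (seq \<beta>) {..<?N}" for \<beta>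
    unfolding total_degree_def seq_def by (rule sum.reindex_bij_betw[OF e(1), symmetric])
  have le_iff: "\<gamma> \<le> \<beta> \<longleftrightarrow> (\<forall>i<?N. seq \<beta> i = seq \<gamma> i) \<or> (\<exists>k<?N. seq \<gamma> k < seq \<beta> k \<and> (\<forall>i<k. seq \<beta> i = seq \<gamma> i))" for \<gamma> \<beta>
    unfolding seq_def by (rule lex_le_enum[OF e])
  have weight_w: "weight (w k)" for k
  proof
    fix \<beta> \<gamma>
    have "carry (seq \<alpha>) (seq (\<beta> + \<gamma>)) k = carry (seq \<alpha>) (seq \<beta>) k + carry (seq \<alpha>) (seq \<gamma>) k"
      by (rule carry_add) (simp add: seq_def lookup_add)
    then show "w k (\<beta> + \<gamma>) = w k \<beta> + w k \<gamma>"
      by (simp add: w_def lex_weight_def seq_def lookup_add algebra_simps)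
  qed
  \<comment> \<open>Beyond the number of variables \<open>e\<close> is unspecified, so sequences can
    only be compared below it.\<close>
  have w_cong: "w k \<beta> = lex_weight (seq \<alpha>) k b" if "k < ?N" "\<And>i. i < ?N \<Longrightarrow> seq \<beta> i = b i" for k \<beta> b
  proof -
    have "carry (seq \<alpha>) (seq \<beta>) k = carry (seq \<alpha>) b k"
      \<comment> \<open>A zero summand turns additivity into congruence.\<close>
      using carry_add[of k "seq \<beta>" b "\<lambda>_. 0" "seq \<alpha>"] carry_add[of k b "seq \<beta>" "\<lambda>_. 0" "seq \<alpha>"] that by simp
    with that show ?thesis
      by (simp add: w_def lex_weight_def)
  qed
  have w_lex: "w k \<alpha> \<le> w k \<gamma>" if "\<alpha> \<le> \<gamma>" "k < ?N" for k \<gamma>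
    using that(1)[unfolded le_iff]
  proof
    assume "\<forall>i<?N. seq \<gamma> i = seq \<alpha> i"
    then show ?thesis
      using w_cong[of k \<gamma> "seq \<alpha>"] that(2) by (simp add: w_def)
  next
    assume "\<exists>k<?N. seq \<alpha> k < seq \<gamma> k \<and> (\<forall>i<k. seq \<gamma> i = seq \<alpha> i)"
    then show ?thesis
      unfolding w_def using lex_weight_mono_lex by blast
  qed
  have power: "\<beta> \<in> exponent_power A m"
    if "\<And>k. k < ?N \<Longrightarrow> m * w k \<alpha> \<le> w k \<beta>" "m * total_degree \<alpha> \<le> total_degree \<beta>" for \<beta> m
    using that
  proof (induction m arbitrary: \<beta>)
    case (Suc m)
    obtain g where g: "\<And>i. i < ?N \<Longrightarrow> g i \<le> seq \<beta> i" "sum g {..<?N} = sum (seq \<alpha>) {..<?N}"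
      "(\<forall>i<?N. g i = seq \<alpha> i) \<or> (\<exists>k<?N. seq \<alpha> k < g k \<and> (\<forall>i<k. g i = seq \<alpha> i))"
      "\<And>k. k < ?N \<Longrightarrow> m * lex_weight (seq \<alpha>) k (seq \<alpha>) \<le> lex_weight (seq \<alpha>) k (\<lambda>i. seq \<beta> i - g i)"
      using lex_split[of ?N m "seq \<alpha>" "seq \<beta>"] Suc.prems unfolding w_def deg by blast
    define \<gamma> where "\<gamma> = Abs_poly_mapping (\<lambda>j. g (the_inv_into {..<?N} e j))"
    have inj: "inj_on e {..<?N}"
      using e(1) by (simp add: bij_betw_def)
    have \<gamma>: "seq \<gamma> i = g i" if "i < ?N" for i
      using that by (simp add: seq_def \<gamma>_def the_inv_into_f_f[OF inj])
    define \<delta> where "\<delta> = \<beta> - \<gamma>"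
    have \<delta>: "seq \<delta> i = seq \<beta> i - g i" if "i < ?N" for i
      using \<gamma>[OF that] by (simp add: seq_def \<delta>_def lookup_minus)
    have "\<beta> = \<gamma> + \<delta>"
    proof (rule poly_mapping_eqI)
      fix j
      obtain i where "i < ?N" "j = e i"
        using e(1) by (auto simp: bij_betw_def)
      then show "lookup \<beta> j = lookup (\<gamma> + \<delta>) j"
        using \<gamma>[of i] \<delta>[of i] g(1)[of i] by (simp add: seq_def lookup_add)
    qed
    have deg_\<gamma>: "total_degree \<gamma> = total_degree \<alpha>"
      using \<gamma> g(2) by (simp add: deg)
    have "\<alpha> \<le> \<gamma>"
      unfolding le_iff using g(3) by (auto simp: \<gamma>)
    with deg_\<gamma> have "\<gamma> \<in> A"
      by (rule segment)
    moreover have "\<delta> \<in> exponent_power A m"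
    proof (rule Suc.IH)
      fix k assume "k < ?N"
      then show "m * w k \<alpha> \<le> w k \<delta>"
        using g(4)[of k] w_cong[of k \<delta> "\<lambda>i. seq \<beta> i - g i"] \<delta> by (simp add: w_def[of k \<alpha>])
    next
      show "m * total_degree \<alpha> \<le> total_degree \<delta>"
        using Suc.prems(2) deg_\<gamma> by (simp add: \<open>\<beta> = \<gamma> + \<delta>\<close> total_degree_add)
    qed
    ultimately show ?case
      unfolding \<open>\<beta> = \<gamma> + \<delta>\<close> by (rule exponent_power_Suc)
  qed simp
  show ?thesis
  proof (rule normal_mono_ideal[where W = W])
    fix v c assume "(v, c) \<in> W"
    then consider "v = total_degree" "c = total_degree \<alpha>" | k where "k < ?N" "v = w k" "c = w k \<alpha>"
      by (auto simp: W_def)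
    then show "weight v \<and> A \<subseteq> weight_ge v c"
    proof cases
      case 1
      have "weight total_degree"
        by standard (rule total_degree_add)
      moreover have "total_degree \<alpha> \<le> total_degree \<beta>" if "\<beta> \<in> A" for \<beta>
        using generated[OF that] by (auto simp: total_degree_add)
      ultimately show ?thesis
        by (auto simp: 1 weight_ge_def)
    next
      case 2
      have "w k \<alpha> \<le> w k \<beta>" if \<beta>: "\<beta> \<in> A" for \<beta>
      proof -
        obtain \<gamma> \<delta> where "\<beta> = \<gamma> + \<delta>" "\<alpha> \<le> \<gamma>"
          using generated[OF \<beta>] by blast
        then show ?thesis
          using w_lex[OF _ 2(1), of \<gamma>] weight.weight_add[OF weight_w, of k \<gamma> \<delta>] by simp
      qed
      then show ?thesis
        using weight_w by (auto simp: 2 weight_ge_def)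
    qed
  next
    fix m
    show "(\<Inter>(v, c)\<in>W. weight_ge v (m * c)) \<subseteq> exponent_power A m"
      by (auto simp: W_def weight_ge_def intro!: power)
  qed
qed

text \<open>A divisor of \<open>\<beta>\<close> in \<open>A\<close> of least degree is minimal,
  since a proper divisor of it would have smaller degree.\<close>

lemma minimal_generator_below:
  fixes A :: "('n::finite \<Rightarrow>\<^sub>0 nat) set"
  assumes "\<beta> \<in> A"
  obtains \<gamma> \<delta> where "\<gamma> \<in> minimal_generators (mono_ideal A :: ('n, 'k::comm_ring_1) mpoly set)"
    "\<gamma> \<in> A" "\<beta> = \<gamma> + \<delta>"
proof -
  obtain \<gamma> where \<gamma>: "\<gamma> \<in> A" "\<exists>\<delta>. \<beta> = \<gamma> + \<delta>"
    and min: "\<And>\<gamma>'. \<gamma>' \<in> A \<Longrightarrow> \<exists>\<delta>. \<beta> = \<gamma>' + \<delta> \<Longrightarrow> total_degree \<gamma> \<le> total_degree \<gamma>'"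
    using ex_has_least_nat[of "\<lambda>\<gamma>. \<gamma> \<in> A \<and> (\<exists>\<delta>. \<beta> = \<gamma> + \<delta>)" \<beta> total_degree] assms
    by (metis add.right_neutral)
  have "\<gamma>' = \<gamma>" if \<gamma>': "\<gamma>' \<in> A" "(monomial \<gamma>' :: ('n, 'k) mpoly) dvd monomial \<gamma>" for \<gamma>'
  proof -
    obtain f where "(monomial \<gamma> :: ('n, 'k) mpoly) = monomial \<gamma>' * f"
      using \<gamma>'(2) by (auto simp: dvd_def)
    \<comment> \<open>Divisibility of polynomials becomes divisibility of exponents by inspecting
      the support of the product.\<close>
    then have "\<gamma> \<in> keys ((monomial \<gamma>' :: ('n, 'k) mpoly) * f)"
      by (metis keys_single monomial_def insertI1 zero_neq_one)
    then have "\<gamma> \<in> {a + b |a b. a \<in> keys (monomial \<gamma>' :: ('n, 'k) mpoly) \<and> b \<in> keys f}"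
      using keys_mult[of "monomial \<gamma>' :: ('n, 'k) mpoly" f] by blast
    then obtain \<delta> where \<delta>: "\<gamma> = \<gamma>' + \<delta>"
      by (auto simp: monomial_def)
    with \<gamma>(2) have "\<exists>\<delta>. \<beta> = \<gamma>' + \<delta>"
      by (metis add.assoc)
    from min[OF \<gamma>'(1) this] have "total_degree \<delta> = 0"
      by (simp add: \<delta> total_degree_add)
    then have "\<delta> = 0"
      by (intro poly_mapping_eqI) (simp add: total_degree_def)
    with \<delta> show ?thesis by simp
  qed
  then show ?thesis
    using \<gamma> that by (auto simp: minimal_generators_def)
qed

lemma finite_total_degree: "finite {\<gamma> :: 'n::finite \<Rightarrow>\<^sub>0 nat. total_degree \<gamma> = d}"
proof (rule finite_subset)
  have "finite {f :: 'n \<Rightarrow> nat. \<forall>x. f x \<le> d}"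
    using finite_set_of_finite_funs[of "UNIV :: 'n set" "{..d}"] by simp
  then show "finite (lookup -` {f :: 'n \<Rightarrow> nat. \<forall>x. f x \<le> d})"
    by (rule finite_vimageI) (metis injI poly_mapping_eq_iff)
  show "{\<gamma> :: 'n \<Rightarrow>\<^sub>0 nat. total_degree \<gamma> = d} \<subseteq> lookup -` {f. \<forall>x. f x \<le> d}"
    unfolding total_degree_def by (auto intro: member_le_sum)
qed

text \<open>Only finitely many exponents have the common degree \<open>d\<close>, so a nonzero ideal
  has a lexicographically least one among them; it generates the lex-segment.\<close>

lemma normal_equigenerated_lex_segment_ideal:
  fixes J :: "('n::{finite, linorder}, 'k::idom) mpoly set"
  assumes "equigenerated J" and lex: "lex_segment_ideal J"
  shows "normal_ideal J"
proof -
  obtain A where A: "up_closed A" "J = mono_ideal A"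
    using lex by (meson lex_segment_ideal_def monomial_idealE)
  obtain d where d: "\<And>\<alpha>. \<alpha> \<in> minimal_generators J \<Longrightarrow> total_degree \<alpha> = d"
    using assms(1) by (auto simp: equigenerated_def)
  show ?thesis
  proof (cases "A = {}")
    case True
    have "normal_ideal (mono_ideal A :: ('n, 'k) mpoly set)"
    \<comment> \<open>For the zero ideal every degree bound holds vacuously, and for
      \<open>m > 0\<close> the bound \<open>total_degree \<beta> + 1\<close> excludes
      \<open>\<beta>\<close>.\<close>
    proof (rule normal_mono_ideal[where W = "{total_degree} \<times> UNIV"])
      fix m
      have "\<beta> \<notin> (\<Inter>(w, c)\<in>{total_degree} \<times> UNIV. weight_ge w (m * c))" if "m \<noteq> 0" for \<beta> :: "'n \<Rightarrow>\<^sub>0 nat"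
      proof -
        have "\<not> m * Suc (total_degree \<beta>) \<le> total_degree \<beta>"
          using that by (cases m) auto
        then show ?thesis
          by (auto simp: weight_ge_def simp del: mult_Suc_right)
      qed
      then show "(\<Inter>(w, c)\<in>{total_degree} \<times> UNIV. weight_ge w (m * c)) \<subseteq> exponent_power A m"
        by (cases "m = 0") auto
    qed (auto simp: True weight_def total_degree_add)
    then show ?thesis by (simp add: A)
  next
    case False
    let ?S = "{\<gamma> \<in> A. total_degree \<gamma> = d}"
    have below: "\<exists>\<gamma> \<delta>. \<gamma> \<in> ?S \<and> \<beta> = \<gamma> + \<delta>" if \<beta>: "\<beta> \<in> A" for \<beta>
    proof -
      obtain \<gamma> \<delta> where "\<gamma> \<in> minimal_generators J" "\<gamma> \<in> A" "\<beta> = \<gamma> + \<delta>"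
        using minimal_generator_below[OF \<beta>, where 'k = 'k] unfolding A(2) .
      then show ?thesis
        using d by blast
    qed
    have "finite ?S"
      using finite_total_degree[of d] by (rule rev_finite_subset) auto
    moreover have "?S \<noteq> {}"
      using False below by blast
    ultimately obtain \<alpha> where \<alpha>: "\<alpha> \<in> A" "total_degree \<alpha> = d" and min: "\<And>\<gamma>. \<gamma> \<in> ?S \<Longrightarrow> \<alpha> \<le> \<gamma>"
      using Min_in[of ?S] Min_le[of ?S] by blast
    show ?thesis
      unfolding A(2)
    proof (rule normal_lex_segment[of _ \<alpha>])
      fix \<beta> assume "\<beta> \<in> A"
      then obtain \<gamma> \<delta> where "\<gamma> \<in> ?S" "\<beta> = \<gamma> + \<delta>"
        using below by blast
      with min \<alpha>(2) show "\<exists>\<gamma> \<delta>. \<beta> = \<gamma> + \<delta> \<and> total_degree \<gamma> = total_degree \<alpha> \<and> \<alpha> \<le> \<gamma>"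
        by blast
    next
      fix \<gamma> assume \<gamma>: "total_degree \<gamma> = total_degree \<alpha>" "\<alpha> \<le> \<gamma>"
      have "\<gamma> \<in> A" if "\<alpha> < \<gamma>"
        using lex[unfolded lex_segment_ideal_def A(2) monomial_in_mono_ideal, THEN conjunct2, rule_format, of \<alpha> \<gamma>]
          \<alpha>(1) \<gamma>(1) that by blast
      with \<gamma>(2) \<alpha>(1) show "\<gamma> \<in> A"
        unfolding order_le_less by blast
    qed
  qed
qed

theorem proposition4p2:
  shows "(\<forall>J :: ('n::{finite, linorder}, 'k::field) mpoly set.
            strongly_stable J \<and> J \<noteq> UNIV \<and> integrally_closed J \<longrightarrow>
              symmetric_strongly_shifted (symmetrization J) \<and>
              symmetrization J \<noteq> UNIV \<and>
              integrally_closed (symmetrization J)) \<and>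
         (\<forall>I :: ('n, 'k) mpoly set.
            symmetric_strongly_shifted I \<and> I \<noteq> UNIV \<longrightarrow>
              (normal_ideal (Borel (monomial ` partition_Borel_generators I) :: ('n, 'k) mpoly set)
                 \<longrightarrow> normal_ideal I) \<and>
              ((\<exists>\<mu>\<in>partitions. partition_Borel_generators I = {\<mu>}) \<longrightarrow> normal_ideal I) \<and>
              (equigenerated (Borel (monomial ` partition_Borel_generators I) :: ('n, 'k) mpoly set) \<and>
               lex_segment_ideal (Borel (monomial ` partition_Borel_generators I) :: ('n, 'k) mpoly set)
                 \<longrightarrow> normal_ideal I))"
proof (intro conjI allI impI)
  fix J :: "('n, 'k) mpoly set"
  assume J: "strongly_stable J \<and> J \<noteq> UNIV \<and> integrally_closed J"
  then obtain A where A: "stable A" "J = mono_ideal A"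
    by (metis strongly_stableE)
  have "sym_shifted (symmetric_core A)"
    using A(1) by (rule sym_shifted_symmetric_core)
  then show "symmetric_strongly_shifted (symmetrization J)"
    by (simp add: A(2) symmetrization_mono_ideal symmetric_strongly_shifted_mono_ideal sym_shiftedD(1))
  have "symmetrization J \<subseteq> J"
    by (simp add: A(2) symmetrization_mono_ideal mono_ideal_mono symmetric_core_subset)
  with J show "symmetrization J \<noteq> UNIV"
    by auto
  show "integrally_closed (symmetrization J)"
    using J integrally_closed_symmetrization by blast
next
  fix I :: "('n, 'k) mpoly set"
  assume I: "symmetric_strongly_shifted I \<and> I \<noteq> UNIV"
  let ?J = "Borel (monomial ` partition_Borel_generators I) :: ('n, 'k) mpoly set"
  {
    assume "normal_ideal ?J"
    then show "normal_ideal I"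
      using I normal_symmetric_strongly_shifted by blast
  next
    assume "\<exists>\<mu>\<in>partitions. partition_Borel_generators I = {\<mu>}"
    then have "normal_ideal ?J"
      using normal_principal_Borel by auto
    then show "normal_ideal I"
      using I normal_symmetric_strongly_shifted by blast
  next
    assume "equigenerated ?J \<and> lex_segment_ideal ?J"
    then have "normal_ideal ?J"
      using normal_equigenerated_lex_segment_ideal by blast
    then show "normal_ideal I"
      using I normal_symmetric_strongly_shifted by blast
  }
qed

end
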